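(* There is an absolute constant $0<C<\infty$ such that the following holds. For any number of alternatives $k\ge 3$ and $\epsilon>0$, setting $$\delta=\delta(\epsilon)=\exp\left(-\frac{C}{\epsilon^{21}}\right),$$ for every $n\ge 1$, if $F$ is a constitution on $n$ voters and $k$ alternatives satisfying: (1) IIA; (2) $F$ is $k^2\epsilon$ far from any dictator, i.e. $D(F,G)>k^2\epsilon$ for any dictator $G$; (3) for every (ordered) pair of distinct alternatives $a$ and $b$, the probability that $F$ ranks $a$ above $b$ is at least $k^2\epsilon$; then the probability of a non-transitive outcome satisfies $P(F)\ge\delta$.
   Context: A ranking of the $k$ alternatives is a strict linear order on them. A profile is an $n$-tuple $\sigma=(\sigma(1),\ldots,\sigma(n))$ of rankings, one per voter. A constitution $F$ associates to every profile $\sigma$ and every pair of distinct alternatives $a,b$ a strict preference between $a$ and $b$ (the outcome $F(\sigma)$ need not be transitive). $F$ satisfies IIA if for every pair $a,b$ the preference of $F(\sigma)$ between $a$ and $b$ depends only on the relative rankings of $a$ and $b$ by all the voters. $F$ is a dictator if for some voter $i$, $F(\sigma)=\sigma(i)$ for all $\sigma$, or $F(\sigma)=-\sigma(i)$ for all $\sigma$, where $-\sigma(i)$ is the reverse of the ranking $\sigma(i)$. Voters vote independently, each choosing one of the $k!$ rankings uniformly at random; $\mathbf P$ is the corresponding probability. $D(F,G)=\mathbf P[F(\sigma)\ne G(\sigma)]$ and $P(F)=\mathbf P[F(\sigma)\text{ is not transitive}]$. *)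

theory Defs
  imports "HOL-Probability.Probability"
begin

text \<open>
  The alternatives are \<open>{..<k}\<close> and the voters \<open>{..<n}\<close>. Preferences are relations, where
  \<open>(a, b) \<in> r\<close> reads ``\<open>a\<close> is ranked above \<open>b\<close>''.
\<close>

definition rankings :: "nat \<Rightarrow> nat rel set" where
  "rankings k = {r. r \<subseteq> {..<k} \<times> {..<k} \<and> strict_linear_order_on {..<k} r}"

definition profiles :: "nat \<Rightarrow> nat \<Rightarrow> (nat \<Rightarrow> nat rel) set" where
  "profiles n k = {..<n} \<rightarrow>\<^sub>E rankings k"

text \<open>
  The outcome on a profile is a strict preference between any two distinct alternatives, that is, a
  tournament on \<open>{..<k}\<close>. All conditions on constitutions concern values on \<^const>\<open>profiles\<close> only.
\<close>

definition constitution :: "nat \<Rightarrow> nat \<Rightarrow> ((nat \<Rightarrow> nat rel) \<Rightarrow> nat rel) \<Rightarrow> bool" where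
  "constitution n k F \<longleftrightarrow>
     (\<forall>\<sigma>\<in>profiles n k. F \<sigma> \<subseteq> {..<k} \<times> {..<k} \<and> asym (F \<sigma>) \<and> total_on {..<k} (F \<sigma>))"

definition IIA :: "nat \<Rightarrow> nat \<Rightarrow> ((nat \<Rightarrow> nat rel) \<Rightarrow> nat rel) \<Rightarrow> bool" where
  "IIA n k F \<longleftrightarrow>
     (\<forall>a<k. \<forall>b<k. a \<noteq> b \<longrightarrow> (\<forall>\<sigma>\<in>profiles n k. \<forall>\<tau>\<in>profiles n k.
        (\<forall>i<n. (a, b) \<in> \<sigma> i \<longleftrightarrow> (a, b) \<in> \<tau> i) \<longrightarrow> ((a, b) \<in> F \<sigma> \<longleftrightarrow> (a, b) \<in> F \<tau>)))"

definition dictator :: "nat \<Rightarrow> nat \<Rightarrow> ((nat \<Rightarrow> nat rel) \<Rightarrow> nat rel) \<Rightarrow> bool" where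
  "dictator n k G \<longleftrightarrow>
     (\<exists>i<n. (\<forall>\<sigma>\<in>profiles n k. G \<sigma> = \<sigma> i) \<or> (\<forall>\<sigma>\<in>profiles n k. G \<sigma> = (\<sigma> i)\<inverse>))"

text \<open>The default value \<^const>\<open>undefined\<close> outside the voters matches the extensional functions
  in \<^const>\<open>profiles\<close>; see \<open>set_pmf_random_profile\<close>.\<close>

definition random_profile :: "nat \<Rightarrow> nat \<Rightarrow> (nat \<Rightarrow> nat rel) pmf" where
  "random_profile n k = Pi_pmf {..<n} undefined (\<lambda>_. pmf_of_set (rankings k))"

definition disagreement ::
  "nat \<Rightarrow> nat \<Rightarrow> ((nat \<Rightarrow> nat rel) \<Rightarrow> nat rel) \<Rightarrow> ((nat \<Rightarrow> nat rel) \<Rightarrow> nat rel) \<Rightarrow> real" where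
  "disagreement n k F G = measure_pmf.prob (random_profile n k) {\<sigma>. F \<sigma> \<noteq> G \<sigma>}"

definition prob_nontransitive :: "nat \<Rightarrow> nat \<Rightarrow> ((nat \<Rightarrow> nat rel) \<Rightarrow> nat rel) \<Rightarrow> real" where
  "prob_nontransitive n k F = measure_pmf.prob (random_profile n k) {\<sigma>. \<not> trans (F \<sigma>)}"

lemma finite_rankings: "finite (rankings k)"
  by (rule finite_subset[of _ "Pow ({..<k} \<times> {..<k})"]) (auto simp: rankings_def)

lemma rankings_nonempty: "rankings k \<noteq> {}"
proof -
  have "{(a, b). a < b \<and> b < k} \<in> rankings k"
    by (auto simp: rankings_def strict_linear_order_on_def trans_def irrefl_def total_on_def)
  then show ?thesis by blast
qed

lemma set_pmf_random_profile: "set_pmf (random_profile n k) = profiles n k"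
  by (simp add: random_profile_def profiles_def set_Pi_pmf PiE_dflt_def PiE_def Pi_def
      extensional_def finite_rankings rankings_nonempty) auto

end

theory Submission imports Defs begin

text \<open>
  Restrict the constitution to three alternatives \<open>a, b, c\<close>. By IIA the outcome on the three pairs
  is given by Boolean functions \<open>f, g, h\<close> of the bits by which the voters compare \<open>a\<close> with
  \<open>b\<close>, \<open>b\<close> with \<open>c\<close> and \<open>c\<close> with \<open>a\<close>. The three bits of a voter are uniform on the six triples that
  are not all equal, and the outcome on \<open>a, b, c\<close> is a cycle exactly when \<open>f, g, h\<close> have the same
  value. The heart of the proof is that if cycles are rare and none of the functions is nearly
  constant, then all three are close to the bit of one common voter, or all three to its
  negation (\<open>close_to_common_dictator\<close>).

  Two estimates carry this. If a voter \<open>i\<close> has influence on \<open>f\<close> and a different voter \<open>j\<close> has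
  influence on \<open>g\<close>, then cycles are frequent (\<open>two_pivotal_voters\<close>): reverse small-set expansion makes
  \<open>i\<close> pivotal for \<open>f\<close> and \<open>j\<close> pivotal for \<open>g\<close> at the same time, and then the two of them can turn
  \<open>f\<close> and \<open>g\<close> to the value of \<open>h\<close>. On the other hand, if no voter has much influence on \<open>h\<close>, then
  \<open>f = g = h = 1\<close> has a probability that is bounded below by powers of the means of \<open>f, g, h\<close>, whatever
  \<open>f\<close> and \<open>g\<close> are (\<open>low_influence_lower_bound\<close>). To see this, treat the voters one at a time
  and follow the product of the powers of the means: it does not decrease in expectation, unless the
  mean of \<open>h\<close> makes a step that is large in proportion. The bit that a voter contributes to \<open>h\<close> is a
  fair coin whenever the two other bits differ, so it can be partly averaged out; the averaging makes
  hypercontractivity available, which bounds the cost of the large steps in terms of the largest influence.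

  Consequently each of \<open>f, g, h\<close> has an influential voter, it is the same voter for all of them, and
  nobody else is influential. With the ranking of this voter fixed the second estimate applies again:
  for each of the six rankings, one of the restricted functions is nearly constantly zero and
  another one is nearly constantly one. The only way to arrange this is to follow the voter, or to
  oppose the voter, on all three pairs (\<open>common_sign_of_means\<close>).

  Triples of alternatives that share a pair have the same dictator, so one voter serves all pairs, and
  a union bound over the pairs completes the argument (\<open>polynomial_arrow\<close>). The bound on the
  probability of a cycle is a power of \<open>\<epsilon>\<close>, which is stronger than the exponential bound of the theorem.
\<close>

section \<open>Averages over independent votes\<close>

type_synonym bits = "nat \<Rightarrow> bool"

text \<open>
  The average over all bit vectors of length \<open>n\<close>. Voters are peeled off from the last one, so that
  inductive proofs restrict a function by fixing its last bit; the bits beyond \<open>n\<close> are \<open>False\<close>.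
\<close>

primrec cube_avg :: "nat \<Rightarrow> (bits \<Rightarrow> real) \<Rightarrow> real" where
  "cube_avg 0 f = f (\<lambda>_. False)"
| "cube_avg (Suc n) f =
     (cube_avg n (\<lambda>x. f (x(n := True))) + cube_avg n (\<lambda>x. f (x(n := False)))) / 2"

text \<open>
  The expectation over independent voters, each of whom contributes a uniformly random triple of bits
  that are not all equal. These six triples are the six rankings of three alternatives
  \<open>a, b, c\<close>, read off as the bits ``\<open>a\<close> above \<open>b\<close>'', ``\<open>b\<close> above \<open>c\<close>'', ``\<open>c\<close> above \<open>a\<close>''.
\<close>

primrec vote_avg :: "nat \<Rightarrow> (bits \<Rightarrow> bits \<Rightarrow> bits \<Rightarrow> real) \<Rightarrow> real" where
  "vote_avg 0 \<Phi> = \<Phi> (\<lambda>_. False) (\<lambda>_. False) (\<lambda>_. False)"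
| "vote_avg (Suc n) \<Phi> =
     (vote_avg n (\<lambda>x y z. \<Phi> (x(n := True)) (y(n := True)) (z(n := False)))
    + vote_avg n (\<lambda>x y z. \<Phi> (x(n := False)) (y(n := False)) (z(n := True)))
    + vote_avg n (\<lambda>x y z. \<Phi> (x(n := True)) (y(n := False)) (z(n := True)))
    + vote_avg n (\<lambda>x y z. \<Phi> (x(n := True)) (y(n := False)) (z(n := False)))
    + vote_avg n (\<lambda>x y z. \<Phi> (x(n := False)) (y(n := True)) (z(n := True)))
    + vote_avg n (\<lambda>x y z. \<Phi> (x(n := False)) (y(n := True)) (z(n := False)))) / 6"

lemma cube_avg_add: "cube_avg n (\<lambda>x. f x + g x) = cube_avg n f + cube_avg n g"
  by (induction n arbitrary: f g) (simp_all add: field_simps)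

lemma cube_avg_scale: "cube_avg n (\<lambda>x. c * f x) = c * cube_avg n f"
  by (induction n arbitrary: f) (simp_all add: field_simps)

lemma cube_avg_const [simp]: "cube_avg n (\<lambda>x. c) = c"
  by (induction n) simp_all

lemma cube_avg_diff: "cube_avg n (\<lambda>x. f x - g x) = cube_avg n f - cube_avg n g"
  using cube_avg_add[of n f "\<lambda>x. (-1) * g x"] cube_avg_scale[of n "-1" g] by simp

lemma cube_avg_mono: "(\<And>x. f x \<le> g x) \<Longrightarrow> cube_avg n f \<le> cube_avg n g"
proof (induction n arbitrary: f g)
  case (Suc n)
  show ?case using Suc.IH[of "\<lambda>x. f (x(n := True))" "\<lambda>x. g (x(n := True))"]
    Suc.IH[of "\<lambda>x. f (x(n := False))" "\<lambda>x. g (x(n := False))"] Suc.prems by simp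
qed simp

lemma cube_avg_nonneg: "(\<And>x. 0 \<le> f x) \<Longrightarrow> 0 \<le> cube_avg n f"
  using cube_avg_mono[of "\<lambda>_. 0" f n] by simp

lemma cube_avg_le1: "(\<And>x. f x \<le> 1) \<Longrightarrow> cube_avg n f \<le> 1"
  using cube_avg_mono[of f "\<lambda>_. 1" n] by simp

text \<open>Any voter may be conditioned on, and not only the last one; likewise in \<open>vote_avg_fix\<close>.\<close>

lemma cube_avg_fix:
  "i < n \<Longrightarrow> cube_avg n f =
     (cube_avg n (\<lambda>x. f (x(i := True))) + cube_avg n (\<lambda>x. f (x(i := False)))) / 2"
proof (induction n arbitrary: f)
  case (Suc n)
  show ?case
  proof (cases "i = n")
    case True
    show ?thesis unfolding True cube_avg.simps fun_upd_upd by simp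
  next
    case False
    then have "i < n" using Suc.prems by simp
    have swap: "x(n := b, i := b') = x(i := b', n := b)" for x :: bits and b b'
      using False by (simp only: fun_upd_twist)
    note IH = Suc.IH[OF \<open>i < n\<close>, of "\<lambda>x. f (x(n := b))" for b]
    show ?thesis
      unfolding cube_avg.simps(2) IH[of True] IH[of False] swap by (simp add: field_simps)
  qed
qed simp

lemma vote_avg_add: "vote_avg n (\<lambda>x y z. f x y z + g x y z) = vote_avg n f + vote_avg n g"
  by (induction n arbitrary: f g) (simp_all add: add_divide_distrib)

lemma vote_avg_scale: "vote_avg n (\<lambda>x y z. c * f x y z) = c * vote_avg n f"
  by (induction n arbitrary: f) (simp_all add: distrib_left)

lemma vote_avg_mono: "(\<And>x y z. f x y z \<le> g x y z) \<Longrightarrow> vote_avg n f \<le> vote_avg n g"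
proof (induction n arbitrary: f g)
  case (Suc n)
  show ?case
    unfolding vote_avg.simps
    by (intro divide_right_mono add_mono Suc.IH Suc.prems) simp
qed simp

lemma vote_avg_nonneg: "(\<And>x y z. 0 \<le> f x y z) \<Longrightarrow> 0 \<le> vote_avg n f"
  by (induction n arbitrary: f) simp_all

lemma vote_avg_rotate: "vote_avg n (\<lambda>x y z. \<Phi> y z x) = vote_avg n \<Phi>"
proof (induction n arbitrary: \<Phi>)
  case (Suc n)
  have "vote_avg n (\<lambda>x y z. \<Phi> (y(n := b)) (z(n := c)) (x(n := d))) =
      vote_avg n (\<lambda>x y z. \<Phi> (x(n := b)) (y(n := c)) (z(n := d)))" for b c d
    by (rule Suc.IH[of "\<lambda>x y z. \<Phi> (x(n := b)) (y(n := c)) (z(n := d))"])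
  then show ?case by (simp only: vote_avg.simps add_ac)
qed simp

lemma vote_avg_first: "vote_avg n (\<lambda>x y z. f x) = cube_avg n f"
  by (induction n arbitrary: f) (simp_all add: field_simps)

lemma vote_avg_fix:
  "i < n \<Longrightarrow> vote_avg n \<Phi> =
     (vote_avg n (\<lambda>x y z. \<Phi> (x(i := True)) (y(i := True)) (z(i := False)))
    + vote_avg n (\<lambda>x y z. \<Phi> (x(i := False)) (y(i := False)) (z(i := True)))
    + vote_avg n (\<lambda>x y z. \<Phi> (x(i := True)) (y(i := False)) (z(i := True)))
    + vote_avg n (\<lambda>x y z. \<Phi> (x(i := True)) (y(i := False)) (z(i := False)))
    + vote_avg n (\<lambda>x y z. \<Phi> (x(i := False)) (y(i := True)) (z(i := True)))
    + vote_avg n (\<lambda>x y z. \<Phi> (x(i := False)) (y(i := True)) (z(i := False)))) / 6"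
proof (induction n arbitrary: \<Phi>)
  case (Suc n)
  show ?case
  proof (cases "i = n")
    case True
    show ?thesis unfolding True vote_avg.simps fun_upd_upd by simp
  next
    case False
    then have i: "i < n" using Suc.prems by simp
    define V where "V b c d b' c' d' =
        vote_avg n (\<lambda>x y z. \<Phi> (x(i := b', n := b)) (y(i := c', n := c)) (z(i := d', n := d)))"
      for b c d b' c' d'
    have swap: "x(n := b, i := b') = x(i := b', n := b)" for x :: bits and b b'
      using False by (simp only: fun_upd_twist)
    have "vote_avg n (\<lambda>x y z. \<Phi> (x(n := b)) (y(n := c)) (z(n := d))) =
        (V b c d True True False + V b c d False False True + V b c d True False True
       + V b c d True False False + V b c d False True True + V b c d False True False) / 6" for b c d
      unfolding V_def by (subst Suc.IH[OF i]) (simp only: swap)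
    note L = this
    have "vote_avg (Suc n) (\<lambda>x y z. \<Phi> (x(i := b')) (y(i := c')) (z(i := d'))) =
        (V True True False b' c' d' + V False False True b' c' d' + V True False True b' c' d'
       + V True False False b' c' d' + V False True True b' c' d' + V False True False b' c' d') / 6"
      for b' c' d'
      unfolding V_def by (simp only: vote_avg.simps swap)
    note R = this
    show ?thesis unfolding vote_avg.simps(2)[of n \<Phi>] L R by (simp add: field_simps)
  qed
qed simp

text \<open>
  The Cauchy--Schwarz inequality of an indefinite form points the other way on its positive cone. It
  reduces the inequalities below, which are bilinear in two functions of one bit, to one function at a
  time: \<open>A\<close>, \<open>B\<close> are the even and \<open>C\<close>, \<open>D\<close> the odd parts.
\<close>

lemma reverse_cauchy_schwarz:
  fixes A B C D u w X Y :: real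
  assumes "X\<^sup>2 \<le> u * A\<^sup>2 - w * C\<^sup>2" "Y\<^sup>2 \<le> u * B\<^sup>2 - w * D\<^sup>2"
    and "0 \<le> A" "0 \<le> B" "0 \<le> X" "0 \<le> Y" "0 \<le> u" "0 \<le> w"
  shows "X * Y \<le> u * (A * B) - w * (C * D)"
proof -
  have "(X * Y + w * \<bar>C * D\<bar>)\<^sup>2 \<le> (X\<^sup>2 + w * C\<^sup>2) * (Y\<^sup>2 + w * D\<^sup>2)"
  proof -
    have "0 \<le> w * (X * \<bar>D\<bar> - Y * \<bar>C\<bar>)\<^sup>2" using assms by simp
    then show ?thesis
      by (simp add: power2_eq_square abs_mult algebra_simps)
  qed
  also have "\<dots> \<le> (u * A\<^sup>2) * (u * B\<^sup>2)"
    using assms by (intro mult_mono) auto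
  also have "\<dots> = (u * (A * B))\<^sup>2" by (simp add: power2_eq_square)
  finally have "X * Y + w * \<bar>C * D\<bar> \<le> u * (A * B)"
    by (rule power2_le_imp_le) (use assms in simp)
  moreover have "w * (C * D) \<le> w * \<bar>C * D\<bar>" using assms by (intro mult_left_mono) auto
  ultimately show ?thesis by linarith
qed

text \<open>
  The case of one voter of \<open>reverse_small_set_expansion\<close>: two of the three bits agree with
  probability one third, so their even and odd parts enter with weights \<open>1\<close> and \<open>- 1/3\<close>. Squaring the
  averages is what lets the even parts pay for the negatively correlated odd parts.
\<close>

lemma two_point_inequality:
  fixes a1 a0 b1 b0 :: real
  assumes "0 \<le> a1" "0 \<le> a0" "0 \<le> b1" "0 \<le> b0"
  shows "((a1 + a0) / 2)\<^sup>2 * ((b1 + b0) / 2)\<^sup>2 \<le>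
    (a1\<^sup>2 * b1\<^sup>2 + a0\<^sup>2 * b0\<^sup>2 + 2 * (a1\<^sup>2 * b0\<^sup>2 + a0\<^sup>2 * b1\<^sup>2)) / 6"
proof -
  have one: "(((p + q) / 2)\<^sup>2)\<^sup>2 \<le> 1 * ((p\<^sup>2 + q\<^sup>2) / 2)\<^sup>2 - (1/3) * ((p\<^sup>2 - q\<^sup>2) / 2)\<^sup>2" for p q :: real
  proof -
    \<comment> \<open>in terms of the half sum and the half difference, the gap between the sides is a sum of squares\<close>
    define u v where "u = (p + q) / 2" and "v = (p - q) / 2"
    have pq: "p = u + v" "q = u - v" by (simp_all add: u_def v_def field_simps)
    have "1 * ((p\<^sup>2 + q\<^sup>2) / 2)\<^sup>2 - (1/3) * ((p\<^sup>2 - q\<^sup>2) / 2)\<^sup>2 =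
        (((p + q) / 2)\<^sup>2)\<^sup>2 + (2/3) * (u * v)\<^sup>2 + (v\<^sup>2)\<^sup>2"
      unfolding pq by (simp add: power2_eq_square field_simps)
    also have "\<dots> \<ge> (((p + q) / 2)\<^sup>2)\<^sup>2" by simp
    finally show ?thesis .
  qed
  have expand: "1 * ((A + B) / 2 * ((C + D) / 2)) - (1/3) * ((A - B) / 2 * ((C - D) / 2)) =
      (A * C + B * D + 2 * (A * D + B * C)) / 6" for A B C D :: real
    by (simp add: field_simps)
  have "((a1 + a0) / 2)\<^sup>2 * ((b1 + b0) / 2)\<^sup>2 \<le>
    1 * ((a1\<^sup>2 + a0\<^sup>2) / 2 * ((b1\<^sup>2 + b0\<^sup>2) / 2)) - (1/3) * ((a1\<^sup>2 - a0\<^sup>2) / 2 * ((b1\<^sup>2 - b0\<^sup>2) / 2))"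
    by (rule reverse_cauchy_schwarz[OF one one]) simp_all
  then show ?thesis unfolding expand .
qed

text \<open>
  Two of the three bit vectors are correlated, but not so strongly that they could avoid two given
  sets of positive density. The two-point inequality propagates from one voter to \<open>n\<close> voters by
  conditioning on the last one.
\<close>

lemma reverse_small_set_expansion:
  assumes "\<And>x. 0 \<le> p x" "\<And>x. p x \<le> 1" "\<And>x. 0 \<le> q x" "\<And>x. q x \<le> 1"
  shows "(cube_avg n p)\<^sup>2 * (cube_avg n q)\<^sup>2 \<le> vote_avg n (\<lambda>x y z. p x * q y)"
  using assms
proof (induction n arbitrary: p q)
  case 0
  have "(p b)\<^sup>2 \<le> p b" "(q b)\<^sup>2 \<le> q b" for b
    using 0 by (simp_all add: power2_eq_square mult_left_le)
  then show ?case using 0 by (simp add: mult_mono)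
next
  case (Suc n)
  define P where "P b = (\<lambda>x. p (x(n := b)))" for b
  define Q where "Q b = (\<lambda>x. q (x(n := b)))" for b
  have IH: "(cube_avg n (P b))\<^sup>2 * (cube_avg n (Q c))\<^sup>2 \<le> vote_avg n (\<lambda>x y z. P b x * Q c y)" for b c
    unfolding P_def Q_def by (rule Suc.IH) (rule Suc.prems)+
  have nn: "0 \<le> cube_avg n (P b)" "0 \<le> cube_avg n (Q b)" for b
    unfolding P_def Q_def by (rule cube_avg_nonneg, rule Suc.prems)+
  have "(cube_avg (Suc n) p)\<^sup>2 * (cube_avg (Suc n) q)\<^sup>2 =
     ((cube_avg n (P True) + cube_avg n (P False)) / 2)\<^sup>2 * ((cube_avg n (Q True) + cube_avg n (Q False)) / 2)\<^sup>2"
    unfolding P_def Q_def cube_avg.simps ..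
  also note two_point_inequality[OF nn(1) nn(1) nn(2) nn(2)]
  finally show ?case
    using IH[of True True] IH[of False False] IH[of True False] IH[of False True]
    unfolding P_def Q_def vote_avg.simps by argo
qed

section \<open>The inequality for one voter and three functions\<close>

lemma even_part_power8: "1 + 28 * s\<^sup>2 \<le> ((1 + s) ^ 8 + (1 - s) ^ 8) / (2::real)"
proof -
  have "((1 + s) ^ 8 + (1 - s) ^ 8) / 2 = 1 + 28 * s\<^sup>2 + 70 * (s\<^sup>2)\<^sup>2 + 28 * (s^3)\<^sup>2 + (s^4)\<^sup>2"
    by (simp add: eval_nat_numeral algebra_simps)
  then show ?thesis by simp
qed

lemma power16_upper:
  fixes u :: real
  assumes "\<bar>u\<bar> \<le> 1/10"
  shows "(1 + u) ^ 16 \<le> 1 + 16 * u + 211 * u\<^sup>2"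
proof -
  have cube: "u ^ 3 \<le> u\<^sup>2 / 10"
  proof -
    have "u\<^sup>2 * u \<le> u\<^sup>2 * (1/10)" using assms by (intro mult_left_mono) auto
    then show ?thesis by (simp add: power2_eq_square power3_eq_cube)
  qed
  have quart: "u ^ 4 \<le> u\<^sup>2 / 100"
  proof -
    have "\<bar>u\<bar>\<^sup>2 \<le> (1/10)\<^sup>2" using assms by (intro power_mono) auto
    then have "u\<^sup>2 * u\<^sup>2 \<le> u\<^sup>2 * (1/100)"
      by (intro mult_left_mono) (auto simp: power2_eq_square)
    then show ?thesis by (simp add: eval_nat_numeral)
  qed
  have "(1 + u) ^ 4 = 1 + 4 * u + 6 * u\<^sup>2 + 4 * u ^ 3 + u ^ 4"
    by (simp add: eval_nat_numeral algebra_simps)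
  also have "\<dots> \<le> 1 + 4 * u + 7 * u\<^sup>2" using cube quart zero_le_power2[of u] by linarith
  finally have 4: "(1 + u) ^ 4 \<le> 1 + 4 * u + 7 * u\<^sup>2" .
  have "(1 + u) ^ 8 = ((1 + u) ^ 4)\<^sup>2" by (simp flip: power_mult)
  also have "\<dots> \<le> (1 + 4 * u + 7 * u\<^sup>2)\<^sup>2" by (rule power_mono[OF 4]) simp
  also have "\<dots> = 1 + 8 * u + 30 * u\<^sup>2 + 56 * u ^ 3 + 49 * u ^ 4"
    by (simp add: eval_nat_numeral algebra_simps)
  also have "\<dots> \<le> 1 + 8 * u + 37 * u\<^sup>2"
    using cube quart zero_le_power2[of u] by linarith
  finally have 8: "(1 + u) ^ 8 \<le> 1 + 8 * u + 37 * u\<^sup>2" .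
  have "(1 + u) ^ 16 = ((1 + u) ^ 8)\<^sup>2" by (simp flip: power_mult)
  also have "\<dots> \<le> (1 + 8 * u + 37 * u\<^sup>2)\<^sup>2" by (rule power_mono[OF 8]) simp
  also have "\<dots> = 1 + 16 * u + 138 * u\<^sup>2 + 592 * u ^ 3 + 1369 * u ^ 4"
    by (simp add: eval_nat_numeral algebra_simps)
  also have "\<dots> \<le> 1 + 16 * u + 211 * u\<^sup>2"
    using cube quart zero_le_power2[of u] by linarith
  finally show ?thesis .
qed

text \<open>
  The inequality that fixes the exponents 8 and 16 used throughout. To second order at the origin it
  is a positive definite quadratic form in \<open>r\<close> and \<open>s\<close>; each side is replaced by a quadratic
  bound on which this is visible. Some bound on \<open>r\<close> is unavoidable: at \<open>r = 1\<close> the right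
  hand side vanishes, which reflects that a dictator produces no cycles.
\<close>

lemma tilted_inequality:
  fixes r s :: real
  assumes r: "\<bar>r\<bar> \<le> 1/10" and s: "\<bar>s\<bar> \<le> 1"
  shows "(1 + r * s) ^ 16 \<le> (1 - r\<^sup>2) ^ 16 *
    ((2/3) * (((1 + s) ^ 8 + (1 - s) ^ 8) / 2)\<^sup>2 + ((1 + 76 * r\<^sup>2) / 3) * (1 - s\<^sup>2) ^ 8)"
proof -
  have r2: "r\<^sup>2 \<le> 1/100" using power_mono[OF r, of 2] by (simp add: power2_eq_square)
  have s2: "s\<^sup>2 \<le> 1" using power_mono[OF s, of 2] by simp
  have nn: "0 \<le> r\<^sup>2" "0 \<le> s\<^sup>2" by simp_all
  have rs2: "(r * s)\<^sup>2 \<le> s\<^sup>2 / 100"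
    using mult_right_mono[OF r2 nn(2)] by (simp add: power_mult_distrib)
  have "(1 + 28 * s\<^sup>2)\<^sup>2 \<le> (((1 + s) ^ 8 + (1 - s) ^ 8) / 2)\<^sup>2"
    by (rule power_mono[OF even_part_power8]) simp
  moreover have "1 + 56 * s\<^sup>2 \<le> (1 + 28 * s\<^sup>2)\<^sup>2"
    by (simp add: power2_sum power_mult_distrib)
  ultimately have e: "1 + 56 * s\<^sup>2 \<le> (((1 + s) ^ 8 + (1 - s) ^ 8) / 2)\<^sup>2" by linarith
  have o: "1 - 8 * s\<^sup>2 \<le> (1 - s\<^sup>2) ^ 8"
    using Bernoulli_inequality[of "- s\<^sup>2" 8] s2 by simp
  have t: "1 - 16 * r\<^sup>2 \<le> (1 - r\<^sup>2) ^ 16"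
    using Bernoulli_inequality[of "- r\<^sup>2" 16] r2 by simp
  let ?B = "(2/3) * (((1 + s) ^ 8 + (1 - s) ^ 8) / 2)\<^sup>2 + ((1 + 76 * r\<^sup>2) / 3) * (1 - s\<^sup>2) ^ 8"
  have r2s2: "r\<^sup>2 * s\<^sup>2 \<le> s\<^sup>2 / 100" "r\<^sup>2 * r\<^sup>2 \<le> r\<^sup>2 / 100"
    using mult_right_mono[OF r2 nn(2)] mult_right_mono[OF r2 nn(1)] by simp_all
  have "(1 + 76 * r\<^sup>2) / 3 * (1 - 8 * s\<^sup>2) \<le> ((1 + 76 * r\<^sup>2) / 3) * (1 - s\<^sup>2) ^ 8"
    using o by (intro mult_left_mono) auto
  moreover have "(1 + 76 * r\<^sup>2) / 3 * (1 - 8 * s\<^sup>2) =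
      1/3 + 76/3 * r\<^sup>2 - 8/3 * s\<^sup>2 - 608/3 * (r\<^sup>2 * s\<^sup>2)"
    by (simp add: field_simps)
  ultimately have B: "1 + 25 * r\<^sup>2 + 32 * s\<^sup>2 \<le> ?B" using e r2s2 nn by linarith
  have disc: "16 * (r * s) \<le> 5 * r\<^sup>2 + 23 * s\<^sup>2"
  proof -
    \<comment> \<open>the discriminant of the quadratic form\<close>
    have "0 \<le> (2 * r - 4 * s)\<^sup>2 + r\<^sup>2 + 7 * s\<^sup>2" by simp
    also have "(2 * r - 4 * s)\<^sup>2 + r\<^sup>2 + 7 * s\<^sup>2 = 5 * r\<^sup>2 + 23 * s\<^sup>2 - 16 * (r * s)"
      by (simp add: power2_eq_square algebra_simps)
    finally show ?thesis by simp
  qed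
  have "(1 + r * s) ^ 16 \<le> 1 + 16 * (r * s) + 211 * (r * s)\<^sup>2"
  proof (rule power16_upper)
    show "\<bar>r * s\<bar> \<le> 1/10" using mult_mono[OF r s] by (simp add: abs_mult)
  qed
  also have "\<dots> \<le> 1 + 9 * r\<^sup>2 + 32 * s\<^sup>2 - 400 * (r\<^sup>2 * r\<^sup>2) - 512 * (r\<^sup>2 * s\<^sup>2)"
    using disc rs2 r2s2 nn by linarith
  also have "\<dots> = (1 - 16 * r\<^sup>2) * (1 + 25 * r\<^sup>2 + 32 * s\<^sup>2)"
    by (simp add: algebra_simps)
  also have "\<dots> \<le> (1 - r\<^sup>2) ^ 16 * ?B"
    using t B r2 nn by (intro mult_mono) auto
  finally show ?thesis .
qed

text \<open>
  The previous inequality for a function of one bit with values proportional to \<open>1 + s\<close> and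
  \<open>1 - s\<close>, in the shape that \<open>reverse_cauchy_schwarz\<close> consumes.
\<close>

lemma tilted_mean:
  fixes p1 p0 r :: real
  assumes p: "0 \<le> p1" "0 \<le> p0" and r: "\<bar>r\<bar> \<le> 1/10"
  shows "(((p1 / (1 - r) + p0 / (1 + r)) / 2) ^ 8)\<^sup>2 \<le>
    (3 + 76 * r\<^sup>2) / 3 * ((p1 ^ 8 + p0 ^ 8) / 2)\<^sup>2 - (1 + 76 * r\<^sup>2) / 3 * ((p1 ^ 8 - p0 ^ 8) / 2)\<^sup>2"
proof (cases "p1 + p0 = 0")
  case True
  then have "p1 = 0" "p0 = 0" using p by auto
  then show ?thesis by simp
next
  case False
  define m where "m = (p1 + p0) / 2"
  define s where "s = (p1 - p0) / (p1 + p0)"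
  have m: "0 < m" using False p by (simp add: m_def)
  have p1: "p1 = m * (1 + s)" and p0: "p0 = m * (1 - s)"
    using False by (simp_all add: m_def s_def field_simps)
  have s: "\<bar>s\<bar> \<le> 1" using False p by (simp add: s_def abs_le_iff field_simps)
  have r2: "r\<^sup>2 \<le> 1/100" using power_mono[OF r, of 2] by (simp add: power2_eq_square)
  have pos: "0 < 1 - r" "0 < 1 + r" "0 < 1 - r\<^sup>2" using r r2 by auto
  have "p1 / (1 - r) + p0 / (1 + r) = (p1 * (1 + r) + p0 * (1 - r)) / ((1 - r) * (1 + r))"
    using pos by (simp add: add_frac_eq)
  also have "(1 - r) * (1 + r) = 1 - r\<^sup>2" by (simp add: power2_eq_square algebra_simps)
  also have "p1 * (1 + r) + p0 * (1 - r) = 2 * (m * (1 + r * s))"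
    unfolding p1 p0 by (simp add: algebra_simps)
  finally have mean: "(p1 / (1 - r) + p0 / (1 + r)) / 2 = m * (1 + r * s) / (1 - r\<^sup>2)"
    using nonzero_mult_div_cancel_left[of 2 "m * (1 + r * s) / (1 - r\<^sup>2)"] by (simp only: times_divide_eq_right)
  let ?E = "((1 + s) ^ 8 + (1 - s) ^ 8) / 2"
  have "(((p1 / (1 - r) + p0 / (1 + r)) / 2) ^ 8)\<^sup>2 = m ^ 16 * ((1 + r * s) ^ 16 / (1 - r\<^sup>2) ^ 16)"
    unfolding mean by (simp add: power_mult_distrib power_divide flip: power_mult)
  also have "\<dots> \<le> m ^ 16 * ((2/3) * ?E\<^sup>2 + ((1 + 76 * r\<^sup>2) / 3) * (1 - s\<^sup>2) ^ 8)"
    using tilted_inequality[OF r s] pos m by (intro mult_left_mono) (simp_all add: field_simps)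
  also have "\<dots> = (2/3) * (m ^ 8 * ?E)\<^sup>2 + (1 + 76 * r\<^sup>2) / 3 * (p1 ^ 8 * p0 ^ 8)"
  proof -
    have "p1 ^ 8 * p0 ^ 8 = m ^ 16 * (1 - s\<^sup>2) ^ 8"
    proof -
      have "p1 * p0 = m\<^sup>2 * (1 - s\<^sup>2)" unfolding p1 p0 by (simp add: power2_eq_square algebra_simps)
      then have "(p1 * p0) ^ 8 = (m\<^sup>2 * (1 - s\<^sup>2)) ^ 8" by simp
      then show ?thesis by (simp add: power_mult_distrib flip: power_mult)
    qed
    moreover have "(m ^ 8 * ?E)\<^sup>2 = m ^ 16 * ?E\<^sup>2"
      by (simp only: power_mult_distrib) (simp flip: power_mult)
    ultimately show ?thesis by (simp only: distrib_left mult_ac)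
  qed
  also have "m ^ 8 * ?E = (p1 ^ 8 + p0 ^ 8) / 2"
    unfolding p1 p0 power_mult_distrib by (simp only: times_divide_eq_right distrib_left)
  also have "(2/3) * ((p1 ^ 8 + p0 ^ 8) / 2)\<^sup>2 + (1 + 76 * r\<^sup>2) / 3 * (p1 ^ 8 * p0 ^ 8) =
    (3 + 76 * r\<^sup>2) / 3 * ((p1 ^ 8 + p0 ^ 8) / 2)\<^sup>2 - (1 + 76 * r\<^sup>2) / 3 * ((p1 ^ 8 - p0 ^ 8) / 2)\<^sup>2"
  proof -
    have "2/3 * ((A + B) / 2)\<^sup>2 + (1 + q) / 3 * (A * B) =
      (3 + q) / 3 * ((A + B) / 2)\<^sup>2 - (1 + q) / 3 * ((A - B) / 2)\<^sup>2" for A B q :: real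
      by (simp add: power2_eq_square field_simps)
    then show ?thesis .
  qed
  finally show ?thesis .
qed

text \<open>
  The third function takes the values \<open>1 + r\<close> and \<open>1 - r\<close>. If the first two bits agree, the third
  is opposite to them; this weight factors as \<open>(1 - r)\<^sup>8 (1 - r)\<^sup>8\<close> or \<open>(1 + r)\<^sup>8 (1 + r)\<^sup>8\<close> and is
  absorbed into the first two functions, which leaves a problem about two functions. If they differ,
  the third bit is a fair coin; a quarter of the time its value is used, and for the rest it is
  averaged out. Averaging part of the third bit gives the smoothing that makes
  \<open>influence_error\<close> small, and using a quarter of it gains \<open>30 r\<^sup>2\<close>, enough to win.
\<close>

lemma three_point_small_step:
  fixes a1 a0 b1 b0 r :: real
  assumes nn: "0 \<le> a1" "0 \<le> a0" "0 \<le> b1" "0 \<le> b0" and r: "\<bar>r\<bar> \<le> 1/10"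
  shows "((a1 + a0) / 2) ^ 8 * ((b1 + b0) / 2) ^ 8 \<le>
    (a1 ^ 8 * b1 ^ 8 * (1 - r) ^ 16 + a0 ^ 8 * b0 ^ 8 * (1 + r) ^ 16
      + (a1 ^ 8 * b0 ^ 8 + a0 ^ 8 * b1 ^ 8) * (3/2 + ((1 + r) ^ 16 + (1 - r) ^ 16) / 4)) / 6"
proof -
  define t where "t = r\<^sup>2"
  have r2: "0 \<le> t" "t \<le> 1/100"
    using power_mono[OF r, of 2] by (simp_all add: t_def power2_eq_square)
  have pos: "0 < 1 - r" "0 < 1 + r" using r by auto
  define A1 A0 B1 B0 where "A1 = a1 * (1 - r)" and "A0 = a0 * (1 + r)"
    and "B1 = b1 * (1 - r)" and "B0 = b0 * (1 + r)"
  have AB: "0 \<le> A1" "0 \<le> A0" "0 \<le> B1" "0 \<le> B0"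
    unfolding A1_def A0_def B1_def B0_def using nn pos by auto
  have quot: "A1 / (1 - r) = a1" "A0 / (1 + r) = a0" "B1 / (1 - r) = b1" "B0 / (1 + r) = b0"
    unfolding A1_def A0_def B1_def B0_def using pos by auto
  have expand: "(3 + 76 * t) / 3 * ((A + B) / 2 * ((C + D) / 2)) - (1 + 76 * t) / 3 * ((A - B) / 2 * ((C - D) / 2))
      = (A * C + B * D + 2 * (1 + 38 * t) * (A * D + B * C)) / 6" for A B C D :: real
    by (simp add: field_simps)
  have "((a1 + a0) / 2) ^ 8 * ((b1 + b0) / 2) ^ 8 \<le>
      (3 + 76 * r\<^sup>2) / 3 * ((A1 ^ 8 + A0 ^ 8) / 2 * ((B1 ^ 8 + B0 ^ 8) / 2))
    - (1 + 76 * r\<^sup>2) / 3 * ((A1 ^ 8 - A0 ^ 8) / 2 * ((B1 ^ 8 - B0 ^ 8) / 2))"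
    by (rule reverse_cauchy_schwarz[OF tilted_mean[OF AB(1,2) r, unfolded quot] tilted_mean[OF AB(3,4) r, unfolded quot]])
      (use nn AB in auto)
  also have "\<dots> = (A1 ^ 8 * B1 ^ 8 + A0 ^ 8 * B0 ^ 8
      + 2 * (1 + 38 * t) * (A1 ^ 8 * B0 ^ 8 + A0 ^ 8 * B1 ^ 8)) / 6"
    unfolding t_def[symmetric] by (rule expand)
  also have "A1 ^ 8 * B1 ^ 8 = a1 ^ 8 * b1 ^ 8 * (1 - r) ^ 16"
    by (simp add: A1_def B1_def power_mult_distrib flip: power_add)
  also have "A0 ^ 8 * B0 ^ 8 = a0 ^ 8 * b0 ^ 8 * (1 + r) ^ 16"
    by (simp add: A0_def B0_def power_mult_distrib flip: power_add)
  also have "A1 ^ 8 * B0 ^ 8 + A0 ^ 8 * B1 ^ 8 = (1 - t) ^ 8 * (a1 ^ 8 * b0 ^ 8 + a0 ^ 8 * b1 ^ 8)"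
  proof -
    have "A1 * B0 = (1 - t) * (a1 * b0)" "A0 * B1 = (1 - t) * (a0 * b1)"
      by (simp_all add: A1_def A0_def B1_def B0_def t_def power2_eq_square algebra_simps)
    then show ?thesis by (simp only: distrib_left flip: power_mult_distrib)
  qed
  finally have main: "((a1 + a0) / 2) ^ 8 * ((b1 + b0) / 2) ^ 8 \<le>
      (a1 ^ 8 * b1 ^ 8 * (1 - r) ^ 16 + a0 ^ 8 * b0 ^ 8 * (1 + r) ^ 16
      + 2 * (1 + 38 * t) * ((1 - t) ^ 8 * (a1 ^ 8 * b0 ^ 8 + a0 ^ 8 * b1 ^ 8))) / 6" .
  have "(1 - t) ^ 8 * (1 + 38 * t) \<le> (1 - t) ^ 8 * ((1 + 8 * t) * (1 + 30 * t))"
    using r2 by (intro mult_left_mono) (simp_all add: algebra_simps)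
  also have "\<dots> \<le> 1 * (1 + 30 * t)"
  proof -
    have "(1 - t) ^ 8 * (1 + 8 * t) \<le> (1 - t) ^ 8 * (1 + t) ^ 8"
      using Bernoulli_inequality[of t 8] r2 by (intro mult_left_mono) auto
    also have "\<dots> = (1 - t\<^sup>2) ^ 8" by (simp add: power2_eq_square algebra_simps flip: power_mult_distrib)
    also have "\<dots> \<le> 1" using r2 by (intro power_le_one) (auto simp: power_le_one)
    finally show ?thesis using r2 by (simp add: mult.assoc[symmetric] mult_right_mono)
  qed
  also have "1 * (1 + 30 * t) \<le> 3/4 + ((1 + r) ^ 16 + (1 - r) ^ 16) / 8"
  proof -
    define E D where "E = ((1 + r) ^ 8 + (1 - r) ^ 8) / 2" and "D = ((1 + r) ^ 8 - (1 - r) ^ 8) / 2"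
    have "(1 + r) ^ 16 + (1 - r) ^ 16 = 2 * E\<^sup>2 + 2 * D\<^sup>2"
    proof -
      have "x\<^sup>2 + y\<^sup>2 = 2 * ((x + y) / 2)\<^sup>2 + 2 * ((x - y) / 2)\<^sup>2" for x y :: real
        by (simp add: power2_eq_square field_simps)
      from this[of "(1 + r) ^ 8" "(1 - r) ^ 8"] show ?thesis by (simp add: E_def D_def flip: power_mult)
    qed
    moreover have "1 + 56 * t \<le> E\<^sup>2"
    proof -
      have "1 + 56 * t \<le> (1 + 28 * r\<^sup>2)\<^sup>2"
        by (simp add: t_def power2_sum power_mult_distrib)
      also have "\<dots> \<le> E\<^sup>2" unfolding E_def by (rule power_mono[OF even_part_power8]) simp
      finally show ?thesis .
    qed
    moreover have "64 * t \<le> D\<^sup>2"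
    proof -
      have "D = 8 * r * (1 + 7 * t + 7 * t\<^sup>2 + t ^ 3)"
        by (simp add: D_def t_def eval_nat_numeral algebra_simps)
      moreover have "1\<^sup>2 \<le> (1 + 7 * t + 7 * t\<^sup>2 + t ^ 3)\<^sup>2" using r2 by (intro power_mono) auto
      ultimately show ?thesis using r2
        by (simp add: power_mult_distrib t_def[symmetric] mult_le_cancel_left1)
    qed
    ultimately show ?thesis by argo
  qed
  finally have "(1 - t) ^ 8 * (1 + 38 * t) \<le> 3/4 + ((1 + r) ^ 16 + (1 - r) ^ 16) / 8" .
  note reveal = this
  have scale: "2 * y * (z * w) \<le> w * (3/2 + v / 4)" if "z * y \<le> 3/4 + v / 8" "0 \<le> w" for v w y z :: real
    using mult_left_mono[OF that(1), of "2 * w"] that(2) by (simp add: algebra_simps)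
  have "2 * (1 + 38 * t) * ((1 - t) ^ 8 * (a1 ^ 8 * b0 ^ 8 + a0 ^ 8 * b1 ^ 8)) \<le>
      (a1 ^ 8 * b0 ^ 8 + a0 ^ 8 * b1 ^ 8) * (3/2 + ((1 + r) ^ 16 + (1 - r) ^ 16) / 4)"
    by (rule scale[OF reveal]) (use nn in simp)
  then show ?thesis
    by (intro order_trans[OF main] divide_right_mono add_left_mono) simp_all
qed

text \<open>
  If the third function has mean \<open>c\<close> and makes a step \<open>d\<close> that is large compared with \<open>c\<close>, then
  the subtracted cube is at least \<open>c ^ 16\<close> and the left hand side is not positive.
\<close>

lemma three_point_inequality:
  fixes a1 a0 b1 b0 c d :: real
  assumes a: "0 \<le> a1" "a1 \<le> 1" "0 \<le> a0" "a0 \<le> 1" and b: "0 \<le> b1" "b1 \<le> 1" "0 \<le> b0" "b0 \<le> 1"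
    and c: "0 \<le> c" "c \<le> 1"
  shows "((a1 + a0) / 2) ^ 8 * ((b1 + b0) / 2) ^ 8 * c ^ 16 - 1000 * \<bar>d\<bar> ^ 3 \<le>
    (a1 ^ 8 * b1 ^ 8 * (c - d) ^ 16 + a0 ^ 8 * b0 ^ 8 * (c + d) ^ 16
      + (a1 ^ 8 * b0 ^ 8 + a0 ^ 8 * b1 ^ 8) * (3/2 * c ^ 16 + ((c + d) ^ 16 + (c - d) ^ 16) / 4)) / 6"
    (is "?L * c ^ 16 - _ \<le> ?R")
proof (cases "c \<le> 10 * \<bar>d\<bar>")
  case True
  have "?L * c ^ 16 \<le> 1 * c ^ 3"
    using a b c by (intro mult_mono mult_le_one power_le_one power_decreasing) auto
  also have "\<dots> \<le> (10 * \<bar>d\<bar>) ^ 3" using True c by (simp only: mult_1 power_mono)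
  finally have "?L * c ^ 16 - 1000 * \<bar>d\<bar> ^ 3 \<le> 0" by (simp add: power_mult_distrib)
  also have "0 \<le> ?R"
    using a b c by (intro divide_nonneg_nonneg add_nonneg_nonneg mult_nonneg_nonneg) auto
  finally show ?thesis .
next
  case False
  then have c0: "0 < c" by auto
  define r where "r = d / c"
  have d: "d = c * r" using c0 by (simp add: r_def)
  have r: "\<bar>r\<bar> \<le> 1/10" using False c0 by (simp add: r_def field_simps abs_divide)
  have pw: "(c - d) ^ 16 = (1 - r) ^ 16 * c ^ 16" "(c + d) ^ 16 = (1 + r) ^ 16 * c ^ 16"
  proof -
    have "c - d = (1 - r) * c" "c + d = (1 + r) * c" by (simp_all add: d algebra_simps)
    then show "(c - d) ^ 16 = (1 - r) ^ 16 * c ^ 16" "(c + d) ^ 16 = (1 + r) ^ 16 * c ^ 16"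
      by (simp_all only: power_mult_distrib)
  qed
  have "?L * c ^ 16 \<le> (a1 ^ 8 * b1 ^ 8 * (1 - r) ^ 16 + a0 ^ 8 * b0 ^ 8 * (1 + r) ^ 16
      + (a1 ^ 8 * b0 ^ 8 + a0 ^ 8 * b1 ^ 8) * (3/2 + ((1 + r) ^ 16 + (1 - r) ^ 16) / 4)) / 6 * c ^ 16"
    using three_point_small_step[OF a(1,3) b(1,3) r] c by (intro mult_right_mono) auto
  also have "\<dots> = ?R"
  proof -
    have "(X * u + Y * v + Z * (3/2 + (v + u) / 4)) / 6 * w =
      (X * (u * w) + Y * (v * w) + Z * (3/2 * w + (v * w + u * w) / 4)) / 6" for X Y Z u v w :: real
      by (simp add: field_simps)
    then show ?thesis unfolding pw .
  qed
  finally show ?thesis using zero_le_power[OF abs_ge_zero, of d 3] by linarith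
qed

section \<open>Functions without influential voters\<close>

text \<open>
  The total cost of the steps of \<open>h\<close> in \<open>three_point_inequality\<close>, along a random process that
  treats the voters one by one: with probability one quarter each it fixes the bit of the voter to
  true or false, and with probability one half it averages over this bit.
\<close>

primrec influence_error :: "nat \<Rightarrow> (bits \<Rightarrow> real) \<Rightarrow> real" where
  "influence_error 0 h = 0"
| "influence_error (Suc n) h =
     \<bar>(cube_avg n (\<lambda>x. h (x(n := True))) - cube_avg n (\<lambda>x. h (x(n := False)))) / 2\<bar> ^ 3
     + (influence_error n (\<lambda>x. h (x(n := True))) + influence_error n (\<lambda>x. h (x(n := False)))) / 4
     + influence_error n (\<lambda>x. (h (x(n := True)) + h (x(n := False))) / 2) / 2"

text \<open>
  The product of powers of the means can only grow in expectation along the process, up to the steps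
  charged to \<open>influence_error\<close>.
\<close>

lemma vote_avg_lower_bound:
  assumes "\<And>x. 0 \<le> f x" "\<And>x. f x \<le> 1" "\<And>x. 0 \<le> g x" "\<And>x. g x \<le> 1"
    and "\<And>x. 0 \<le> h x" "\<And>x. h x \<le> 1"
  shows "cube_avg n f ^ 8 * cube_avg n g ^ 8 * cube_avg n h ^ 16 - 1000 * influence_error n h
    \<le> vote_avg n (\<lambda>x y z. f x * g y * h z)"
  using assms
proof (induction n arbitrary: f g h)
  case 0
  have "t ^ 8 \<le> t" "t ^ 16 \<le> t" if "0 \<le> t" "t \<le> 1" for t :: real
    using power_decreasing[of 1 8 t] power_decreasing[of 1 16 t] that by simp_all
  then show ?case using 0 by (simp add: mult_mono)
next
  case (Suc n)
  define F where "F b = (\<lambda>x. f (x(n := b)))" for b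
  define G where "G b = (\<lambda>x. g (x(n := b)))" for b
  define H where "H b = (\<lambda>x. h (x(n := b)))" for b
  define M where "M = (\<lambda>x. (H True x + H False x) / 2)"
  define N where "N p q s = vote_avg n (\<lambda>x y z. p x * q y * s z)" for p q s
  define a where "a b = cube_avg n (F b)" for b
  define b where "b c = cube_avg n (G c)" for c
  define c where "c = cube_avg n M"
  define d where "d = (cube_avg n (H True) - cube_avg n (H False)) / 2"
  have 01: "0 \<le> F t x" "F t x \<le> 1" "0 \<le> G t x" "G t x \<le> 1" "0 \<le> H t x" "H t x \<le> 1" for t x
    unfolding F_def G_def H_def by (rule Suc.prems)+
  have M01: "0 \<le> M x" "M x \<le> 1" for x
    using 01(5,6)[of True x] 01(5,6)[of False x] by (simp_all add: M_def)
  have ab: "0 \<le> a t" "a t \<le> 1" "0 \<le> b t" "b t \<le> 1" for t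
    unfolding a_def b_def by (intro cube_avg_nonneg cube_avg_le1 01)+
  have c01: "0 \<le> c" "c \<le> 1"
    unfolding c_def by (intro cube_avg_nonneg cube_avg_le1 M01)+
  have "c = (cube_avg n (H True) + cube_avg n (H False)) / 2"
    unfolding c_def M_def
    using cube_avg_scale[of n "1/2" "\<lambda>x. H True x + H False x"] by (simp add: cube_avg_add)
  then have H: "cube_avg n (H True) = c + d" "cube_avg n (H False) = c - d"
    by (simp_all add: d_def field_simps)
  have IH: "a t ^ 8 * b u ^ 8 * cube_avg n (H v) ^ 16 - 1000 * influence_error n (H v) \<le> N (F t) (G u) (H v)" for t u v
    unfolding a_def b_def N_def by (rule Suc.IH) (rule 01)+
  have IHM: "a t ^ 8 * b u ^ 8 * c ^ 16 - 1000 * influence_error n M \<le> N (F t) (G u) M" for t u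
    unfolding a_def b_def c_def N_def by (rule Suc.IH) (rule 01 M01)+
  have split: "N p q (H True) + N p q (H False) = 2 * N p q M" for p q
  proof -
    have "(\<lambda>x y z. p x * q y * M z) = (\<lambda>x y z. (1/2) * (p x * q y * H True z + p x * q y * H False z))"
      by (simp add: M_def fun_eq_iff algebra_simps)
    then show ?thesis unfolding N_def by (simp only: vote_avg_scale vote_avg_add) simp
  qed
  have "vote_avg (Suc n) (\<lambda>x y z. f x * g y * h z) =
     (N (F True) (G True) (H False) + N (F False) (G False) (H True)
    + N (F True) (G False) (H True) + N (F True) (G False) (H False)
    + N (F False) (G True) (H True) + N (F False) (G True) (H False)) / 6"
    unfolding N_def F_def G_def H_def vote_avg.simps ..
  \<comment> \<open>when the first two bits differ, a quarter of the time the third bit is revealed and three quarters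
      of the time it is averaged over\<close>
  also have "\<dots> = (N (F True) (G True) (H False) + N (F False) (G False) (H True)
    + (N (F True) (G False) (H True) + N (F True) (G False) (H False)) / 4 + 3/2 * N (F True) (G False) M
    + (N (F False) (G True) (H True) + N (F False) (G True) (H False)) / 4 + 3/2 * N (F False) (G True) M) / 6"
    using split[of "F True" "G False"] split[of "F False" "G True"] by simp
  finally have N: "vote_avg (Suc n) (\<lambda>x y z. f x * g y * h z) = \<dots>" .
  have err: "influence_error (Suc n) h =
      \<bar>d\<bar> ^ 3 + (influence_error n (H True) + influence_error n (H False)) / 4 + influence_error n M / 2"
    by (simp add: d_def H_def M_def)
  have avg: "cube_avg (Suc n) f = (a True + a False) / 2" "cube_avg (Suc n) g = (b True + b False) / 2"
    "cube_avg (Suc n) h = c"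
    using H by (simp_all add: a_def b_def F_def G_def H_def)
  have expand: "(A1 * B1 * u + A0 * B0 * v + (A1 * B0 + A0 * B1) * (3/2 * w + (v + u) / 4)) / 6 =
    (A1 * B1 * u + A0 * B0 * v + (A1 * B0 * v + A1 * B0 * u) / 4 + 3/2 * (A1 * B0 * w)
     + (A0 * B1 * v + A0 * B1 * u) / 4 + 3/2 * (A0 * B1 * w)) / 6"
    for A1 A0 B1 B0 u v w :: real by (simp add: field_simps)
  show ?case
    using three_point_inequality[OF ab(1,2)[of True] ab(1,2)[of False] ab(3,4)[of True] ab(3,4)[of False] c01, of d]
      IH[of True True False] IH[of False False True] IH[of True False True] IH[of True False False]
      IH[of False True True] IH[of False True False] IHM[of True False] IHM[of False True]
    unfolding N avg err expand H by argo
qed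

text \<open>
  The energy of the \<open>i\<close>-th difference of the martingale that reveals the bits of \<open>h\<close> from the last
  to the first. All bits are revealed here, whereas \<open>influence_error\<close> reveals each with probability
  one half only.
\<close>

primrec step_energy :: "nat \<Rightarrow> nat \<Rightarrow> (bits \<Rightarrow> real) \<Rightarrow> real" where
  "step_energy 0 i h = 0"
| "step_energy (Suc n) i h =
     (if i = n then ((cube_avg n (\<lambda>x. h (x(n := True))) - cube_avg n (\<lambda>x. h (x(n := False)))) / 2)\<^sup>2
      else (step_energy n i (\<lambda>x. h (x(n := True))) + step_energy n i (\<lambda>x. h (x(n := False)))) / 2)"

lemma step_energy_nonneg: "0 \<le> step_energy n i h"
  by (induction n arbitrary: h) simp_all

lemma step_energy_scale: "step_energy n i (\<lambda>x. c * h x) = c\<^sup>2 * step_energy n i h"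
  by (induction n arbitrary: h) (simp_all add: cube_avg_scale power2_eq_square field_simps)

text \<open>The square root of the energy is an \<open>L\<^sup>2\<close> seminorm.\<close>

lemma sqrt_step_energy_triangle:
  "sqrt (step_energy n i (\<lambda>x. f x + g x)) \<le> sqrt (step_energy n i f) + sqrt (step_energy n i g)"
proof (induction n arbitrary: f g)
  case (Suc n)
  show ?case
  proof (cases "i = n")
    case True
    then show ?thesis
      by (simp add: cube_avg_add)
  next
    case False
    define F where "F b = sqrt (step_energy n i (\<lambda>x. f (x(n := b))))" for b
    define G where "G b = sqrt (step_energy n i (\<lambda>x. g (x(n := b))))" for b
    define S where "S b = sqrt (step_energy n i (\<lambda>x. f (x(n := b)) + g (x(n := b))))" for b
    have nn: "0 \<le> F b" "0 \<le> G b" "0 \<le> S b" for b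
      by (simp_all add: F_def G_def S_def step_energy_nonneg)
    have sq: "step_energy n i (\<lambda>x. f (x(n := b))) = (F b)\<^sup>2" "step_energy n i (\<lambda>x. g (x(n := b))) = (G b)\<^sup>2"
      "step_energy n i (\<lambda>x. f (x(n := b)) + g (x(n := b))) = (S b)\<^sup>2" for b
      by (simp_all add: F_def G_def S_def step_energy_nonneg)
    have S: "S b \<le> F b + G b" for b
      unfolding S_def F_def G_def by (rule Suc.IH)
    have "sqrt (((S True)\<^sup>2 + (S False)\<^sup>2)) \<le> sqrt ((F True + G True)\<^sup>2 + (F False + G False)\<^sup>2)"
      using S nn by (intro real_sqrt_le_mono add_mono power_mono) auto
    also have "\<dots> \<le> sqrt ((F True)\<^sup>2 + (F False)\<^sup>2) + sqrt ((G True)\<^sup>2 + (G False)\<^sup>2)"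
      by (rule real_sqrt_sum_squares_triangle_ineq)
    finally have "sqrt (((S True)\<^sup>2 + (S False)\<^sup>2)) / sqrt 2 \<le>
        (sqrt ((F True)\<^sup>2 + (F False)\<^sup>2) + sqrt ((G True)\<^sup>2 + (G False)\<^sup>2)) / sqrt 2"
      by (intro divide_right_mono) auto
    then have "sqrt (((S True)\<^sup>2 + (S False)\<^sup>2) / 2) \<le>
        sqrt (((F True)\<^sup>2 + (F False)\<^sup>2) / 2) + sqrt (((G True)\<^sup>2 + (G False)\<^sup>2) / 2)"
      unfolding real_sqrt_divide by (simp only: add_divide_distrib)
    then show ?thesis using False unfolding step_energy.simps sq by simp
  qed
qed simp

lemma sqrt_step_energy_avg:
  "sqrt (step_energy n i (\<lambda>x. (f x + g x) / 2)) \<le> (sqrt (step_energy n i f) + sqrt (step_energy n i g)) / 2"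
proof -
  have "step_energy n i (\<lambda>x. (f x + g x) / 2) = step_energy n i (\<lambda>x. f x + g x) / 4"
    using step_energy_scale[of n i "1/2" "\<lambda>x. f x + g x"] by (simp add: power2_eq_square)
  then have "sqrt (step_energy n i (\<lambda>x. (f x + g x) / 2)) = sqrt (step_energy n i (\<lambda>x. f x + g x)) / 2"
    by (simp only: real_sqrt_divide real_sqrt_four)
  then show ?thesis using sqrt_step_energy_triangle[of n i f g] by simp
qed

text \<open>Martingale differences are orthogonal, so their energies add up to the variance.\<close>

lemma sum_step_energy: "(\<Sum>i<n. step_energy n i h) = cube_avg n (\<lambda>x. (h x)\<^sup>2) - (cube_avg n h)\<^sup>2"
proof (induction n arbitrary: h)
  case (Suc n)
  have "(\<Sum>i<n. step_energy (Suc n) i h) =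
      (\<Sum>i<n. step_energy n i (\<lambda>x. h (x(n := True))) + step_energy n i (\<lambda>x. h (x(n := False)))) / 2"
    unfolding sum_divide_distrib by (rule sum.cong) auto
  then show ?case
    by (simp add: Suc.IH sum.distrib) (simp add: power2_eq_square field_simps)
qed simp

lemma cube_avg_square: "(cube_avg n h)\<^sup>2 \<le> cube_avg n (\<lambda>x. (h x)\<^sup>2)"
  using sum_step_energy[of n h] sum_nonneg[of "{..<n}" "\<lambda>i. step_energy n i h"] step_energy_nonneg
  by simp

lemma step_energy_le_influence:
  "i < n \<Longrightarrow> step_energy n i h \<le> cube_avg n (\<lambda>x. ((h (x(i := True)) - h (x(i := False))) / 2)\<^sup>2)"
proof (induction n arbitrary: h)
  case (Suc n)
  show ?case
  proof (cases "i = n")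
    case True
    have "(cube_avg n (\<lambda>x. h (x(n := True))) - cube_avg n (\<lambda>x. h (x(n := False)))) / 2 =
        cube_avg n (\<lambda>x. (h (x(n := True)) - h (x(n := False))) / 2)"
      using cube_avg_scale[of n "1/2" "\<lambda>x. h (x(n := True)) - h (x(n := False))"]
      by (simp add: cube_avg_diff)
    then show ?thesis using cube_avg_square[of n "\<lambda>x. (h (x(n := True)) - h (x(n := False))) / 2"]
      unfolding True step_energy.simps cube_avg.simps fun_upd_upd by simp
  next
    case False
    then have i: "i < n" using Suc.prems by simp
    have swap: "x(n := b, i := c) = x(i := c, n := b)" for x :: bits and b c
      using False by (simp only: fun_upd_twist)
    note IH = Suc.IH[OF i, of "\<lambda>x. h (x(n := b))" for b]
    show ?thesis
      unfolding step_energy.simps cube_avg.simps if_not_P[OF False] swap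
      by (rule divide_right_mono[OF add_mono[OF IH IH]]) simp
  qed
qed simp

text \<open>
  The two-point hypercontractive inequality from \<open>L\<^sup>2\<close> to \<open>L\<^sup>3\<close>: a bit that is averaged out with
  probability one half turns a third moment into a power of the second moment.
\<close>

lemma cubic_two_point:
  fixes X Y :: real
  assumes "0 \<le> X" "0 \<le> Y"
  shows "(X ^ 3 + Y ^ 3) / 4 + ((X + Y) / 2) ^ 3 / 2 \<le> sqrt ((X\<^sup>2 + Y\<^sup>2) / 2) ^ 3"
proof (rule power2_le_imp_le)
  define a b where "a = (X + Y) / 2" and "b = (X - Y) / 2"
  have XY: "X = a + b" "Y = a - b" by (simp_all add: a_def b_def field_simps)
  have "((X ^ 3 + Y ^ 3) / 4 + ((X + Y) / 2) ^ 3 / 2)\<^sup>2 = (a ^ 3 + 3/2 * (a * b\<^sup>2))\<^sup>2"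
    unfolding XY by (simp add: eval_nat_numeral field_simps)
  also have "\<dots> = (a\<^sup>2 + b\<^sup>2) ^ 3 - 3/4 * (a * b\<^sup>2)\<^sup>2 - (b ^ 3)\<^sup>2"
    by (simp add: eval_nat_numeral field_simps)
  also have "\<dots> \<le> (a\<^sup>2 + b\<^sup>2) ^ 3"
    using zero_le_power2[of "a * b\<^sup>2"] zero_le_power2[of "b ^ 3"] by linarith
  also have "a\<^sup>2 + b\<^sup>2 = (X\<^sup>2 + Y\<^sup>2) / 2"
    unfolding XY by (simp add: power2_eq_square field_simps)
  also have "((X\<^sup>2 + Y\<^sup>2) / 2) ^ 3 = (sqrt ((X\<^sup>2 + Y\<^sup>2) / 2) ^ 3)\<^sup>2"
    by (subst power_mult[symmetric], subst mult.commute, subst power_mult) simp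
  finally show "((X ^ 3 + Y ^ 3) / 4 + ((X + Y) / 2) ^ 3 / 2)\<^sup>2 \<le> (sqrt ((X\<^sup>2 + Y\<^sup>2) / 2) ^ 3)\<^sup>2" .
qed simp

text \<open>
  Hypercontractivity tensorizes: for each voter \<open>i\<close> the two-point inequality is applied once for
  every voter that is revealed before \<open>i\<close>.
\<close>

lemma influence_error_le_energy: "influence_error n h \<le> (\<Sum>i<n. sqrt (step_energy n i h) ^ 3)"
proof (induction n arbitrary: h)
  case (Suc n)
  define H where "H b = (\<lambda>x. h (x(n := b)))" for b
  define M where "M = (\<lambda>x. (H True x + H False x) / 2)"
  have step: "(sqrt (step_energy n i (H True)) ^ 3 + sqrt (step_energy n i (H False)) ^ 3) / 4
      + sqrt (step_energy n i M) ^ 3 / 2 \<le> sqrt (step_energy (Suc n) i h) ^ 3" if "i < n" for i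
  proof -
    have "sqrt (step_energy n i M) ^ 3 \<le>
        ((sqrt (step_energy n i (H True)) + sqrt (step_energy n i (H False))) / 2) ^ 3"
      unfolding M_def by (intro power_mono sqrt_step_energy_avg) (simp add: step_energy_nonneg)
    moreover have energy: "sqrt (step_energy (Suc n) i h) =
        sqrt (((sqrt (step_energy n i (H True)))\<^sup>2 + (sqrt (step_energy n i (H False)))\<^sup>2) / 2)"
      using that by (simp add: H_def step_energy_nonneg)
    moreover note cubic_two_point[OF real_sqrt_ge_zero real_sqrt_ge_zero,
        OF step_energy_nonneg[of n i "H True"] step_energy_nonneg[of n i "H False"]]
    ultimately show ?thesis unfolding energy by linarith
  qed
  have "influence_error (Suc n) h = sqrt (step_energy (Suc n) n h) ^ 3
      + ((influence_error n (H True) + influence_error n (H False)) / 4 + influence_error n M / 2)"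
    by (simp add: H_def M_def)
  also have "\<dots> \<le> sqrt (step_energy (Suc n) n h) ^ 3
      + (\<Sum>i<n. (sqrt (step_energy n i (H True)) ^ 3 + sqrt (step_energy n i (H False)) ^ 3) / 4
      + sqrt (step_energy n i M) ^ 3 / 2)"
    unfolding sum.distrib sum_divide_distrib[symmetric]
    by (intro add_left_mono add_mono divide_right_mono Suc.IH) simp_all
  also have "\<dots> \<le> sqrt (step_energy (Suc n) n h) ^ 3 + (\<Sum>i<n. sqrt (step_energy (Suc n) i h) ^ 3)"
    using step by (intro add_left_mono sum_mono) auto
  finally show ?case by simp
qed simp

definition influence :: "nat \<Rightarrow> nat \<Rightarrow> (bits \<Rightarrow> real) \<Rightarrow> real" where
  "influence n i f = cube_avg n (\<lambda>x. \<bar>f (x(i := True)) - f (x(i := False))\<bar>)"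

text \<open>
  A sum of cubes is at most the largest root energy times the sum of the squares. The former is at
  most \<open>\<rho>\<close> because a voter of small influence has small energy, and the latter is a variance.
\<close>

lemma influence_error_le:
  assumes h: "\<And>x. h x \<in> {0, 1}" and infl: "\<And>i. i < n \<Longrightarrow> influence n i h \<le> 2 * \<rho>\<^sup>2" and \<rho>: "0 \<le> \<rho>"
  shows "influence_error n h \<le> \<rho>"
proof -
  have le: "sqrt (step_energy n i h) \<le> \<rho>" if i: "i < n" for i
  proof -
    have "((h y - h z) / 2)\<^sup>2 = (1/4) * \<bar>h y - h z\<bar>" for y z
      using h[of y] h[of z] by (auto simp: power2_eq_square)
    then have "step_energy n i h \<le> (1/4) * influence n i h"
      using step_energy_le_influence[OF i, of h] unfolding influence_def
      by (simp only: cube_avg_scale)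
    also have "\<dots> \<le> \<rho>\<^sup>2" using infl[OF i] zero_le_power2[of \<rho>] by linarith
    finally show ?thesis using \<rho> by (rule real_le_lsqrt[rotated])
  qed
  have "influence_error n h \<le> (\<Sum>i<n. sqrt (step_energy n i h) ^ 3)"
    by (rule influence_error_le_energy)
  also have "\<dots> \<le> (\<Sum>i<n. \<rho> * step_energy n i h)"
  proof (rule sum_mono)
    fix i assume "i \<in> {..<n}"
    then have "sqrt (step_energy n i h) * step_energy n i h \<le> \<rho> * step_energy n i h"
      using le by (intro mult_right_mono) (auto simp: step_energy_nonneg)
    then show "sqrt (step_energy n i h) ^ 3 \<le> \<rho> * step_energy n i h"
      by (simp add: power3_eq_cube step_energy_nonneg mult.commute)
  qed
  also have "\<dots> = \<rho> * (cube_avg n (\<lambda>x. (h x)\<^sup>2) - (cube_avg n h)\<^sup>2)"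
    by (simp add: sum_step_energy flip: sum_distrib_left)
  also have "\<dots> \<le> \<rho> * 1"
  proof (rule mult_left_mono[OF _ \<rho>])
    have "(h x)\<^sup>2 \<le> 1" for x using h[of x] by auto
    then have "cube_avg n (\<lambda>x. (h x)\<^sup>2) \<le> 1" by (rule cube_avg_le1)
    then show "cube_avg n (\<lambda>x. (h x)\<^sup>2) - (cube_avg n h)\<^sup>2 \<le> 1"
      using zero_le_power2[of "cube_avg n h"] by linarith
  qed
  finally show ?thesis by simp
qed

text \<open>
  Whatever \<open>f\<close> and \<open>g\<close> are, they are both one with a probability bounded below, and a function \<open>h\<close> without
  influential voters cannot be zero on nearly all of this event.
\<close>

lemma low_influence_lower_bound:
  assumes f: "\<And>x. f x \<in> {0, 1}" and g: "\<And>x. g x \<in> {0, 1}" and h: "\<And>x. h x \<in> {0, 1}"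
    and infl: "\<And>i. i < n \<Longrightarrow> influence n i h \<le> 2 * \<rho>\<^sup>2" and \<rho>: "0 \<le> \<rho>" and \<eta>: "0 \<le> \<eta>"
    and mean: "\<eta> \<le> cube_avg n f" "\<eta> \<le> cube_avg n g" "\<eta> \<le> cube_avg n h"
  shows "\<eta> ^ 32 - 1000 * \<rho> \<le> vote_avg n (\<lambda>x y z. f x * g y * h z)"
proof -
  have 01: "0 \<le> f x" "f x \<le> 1" "0 \<le> g x" "g x \<le> 1" "0 \<le> h x" "h x \<le> 1" for x
    using f[of x] g[of x] h[of x] by auto
  have "\<eta> ^ 8 * \<eta> ^ 8 * \<eta> ^ 16 \<le> cube_avg n f ^ 8 * cube_avg n g ^ 8 * cube_avg n h ^ 16"
    using \<eta> mean by (intro mult_mono power_mono) auto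
  moreover have "\<eta> ^ 8 * \<eta> ^ 8 * \<eta> ^ 16 = \<eta> ^ 32" by (simp flip: power_add)
  moreover have "influence_error n h \<le> \<rho>" using h infl \<rho> by (rule influence_error_le)
  ultimately show ?thesis using vote_avg_lower_bound[of f g h n, OF 01] by linarith
qed

section \<open>Two pivotal voters\<close>

text \<open>For functions with values 0 and 1, the indicator of the cyclic outcomes.\<close>

definition all_equal :: "(bits \<Rightarrow> real) \<Rightarrow> (bits \<Rightarrow> real) \<Rightarrow> (bits \<Rightarrow> real) \<Rightarrow> bits \<Rightarrow> bits \<Rightarrow> bits \<Rightarrow> real" where
  "all_equal f g h = (\<lambda>x y z. f x * g y * h z + (1 - f x) * (1 - g y) * (1 - h z))"

text \<open>
  A quantitative form of the lemma of Barbera. Let \<open>i\<close> be pivotal for \<open>f\<close> and \<open>j\<close> be pivotal for \<open>g\<close>.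
  If the second and third bits of \<open>i\<close> differ, then the first bit of \<open>i\<close> is free; if the first and
  third bits of \<open>j\<close> differ, then the second bit of \<open>j\<close> is free. The two free bits set \<open>f\<close> and \<open>g\<close>
  to the value of \<open>h\<close>, which they do not affect. Both voters are pivotal at once with the
  probability given by \<open>reverse_small_set_expansion\<close>.
\<close>

lemma two_pivotal_voters:
  assumes f: "\<And>x. f x \<in> {0, 1}" and g: "\<And>x. g x \<in> {0, 1}" and h: "\<And>x. h x \<in> {0, 1}"
    and ij: "i < n" "j < n" "i \<noteq> j"
  shows "(influence n i f)\<^sup>2 * (influence n j g)\<^sup>2 / 9 \<le> vote_avg n (all_equal f g h)"
proof -
  define p where "p b = (\<lambda>x. \<bar>f (x(j := b, i := True)) - f (x(j := b, i := False))\<bar>)" for b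
  define q where "q b = (\<lambda>y. \<bar>g (y(i := b, j := True)) - g (y(i := b, j := False))\<bar>)" for b
  define N where "N t u v t' u' v' = vote_avg n (\<lambda>x y z. all_equal f g h
      (x(j := t', i := t)) (y(j := u', i := u)) (z(j := v', i := v)))" for t u v t' u' v'
  have swap: "y(i := b, j := c) = y(j := c, i := b)" for y :: bits and b c
    using ij by (simp only: fun_upd_twist)
  have nn: "0 \<le> all_equal f g h x y z" for x y z
    using f[of x] g[of y] h[of z] by (auto simp: all_equal_def)
  have N0: "0 \<le> N t u v t' u' v'" for t u v t' u' v'
    unfolding N_def by (rule vote_avg_nonneg) (rule nn)
  \<comment> \<open>on the right, exactly one of the four choices of the two free bits makes all functions equal\<close>
  have pivot: "vote_avg n (\<lambda>x y z. p b x * q c y) \<le>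
      N True c (\<not> c) b True (\<not> b) + N True c (\<not> c) b False (\<not> b)
    + N False c (\<not> c) b True (\<not> b) + N False c (\<not> c) b False (\<not> b)" for b c
    unfolding N_def vote_avg_add[symmetric]
  proof (rule vote_avg_mono)
    fix x y z
    show "p b x * q c y \<le>
        all_equal f g h (x(j := b, i := True)) (y(j := True, i := c)) (z(j := \<not> b, i := \<not> c))
      + all_equal f g h (x(j := b, i := True)) (y(j := False, i := c)) (z(j := \<not> b, i := \<not> c))
      + all_equal f g h (x(j := b, i := False)) (y(j := True, i := c)) (z(j := \<not> b, i := \<not> c))
      + all_equal f g h (x(j := b, i := False)) (y(j := False, i := c)) (z(j := \<not> b, i := \<not> c))"
      using f[of "x(j := b, i := True)"] f[of "x(j := b, i := False)"]
        g[of "y(j := True, i := c)"] g[of "y(j := False, i := c)"] h[of "z(j := \<not> b, i := \<not> c)"]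
      unfolding p_def q_def swap all_equal_def by auto
  qed
  have lower: "(cube_avg n (p b))\<^sup>2 * (cube_avg n (q c))\<^sup>2 \<le> vote_avg n (\<lambda>x y z. p b x * q c y)" for b c
  proof (rule reverse_small_set_expansion)
    show "p b x \<le> 1" for x
      using f[of "x(j := b, i := True)"] f[of "x(j := b, i := False)"] by (auto simp: p_def)
    show "q c x \<le> 1" for x
      using g[of "x(i := c, j := True)"] g[of "x(i := c, j := False)"] by (auto simp: q_def)
  qed (simp_all add: p_def q_def)
  have infl: "influence n i f = (cube_avg n (p True) + cube_avg n (p False)) / 2"
    "influence n j g = (cube_avg n (q True) + cube_avg n (q False)) / 2"
    unfolding influence_def p_def q_def
    by (subst cube_avg_fix[OF ij(2)], simp only: swap, subst cube_avg_fix[OF ij(1)], simp only: swap)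
  have square: "2 * ((u + v) / 2)\<^sup>2 \<le> u\<^sup>2 + v\<^sup>2" for u v :: real
    using zero_le_power2[of "u - v"] by (simp add: power2_eq_square field_simps)
  have "4 * ((influence n i f)\<^sup>2 * (influence n j g)\<^sup>2) = (2 * (influence n i f)\<^sup>2) * (2 * (influence n j g)\<^sup>2)"
    by simp
  also have "\<dots> \<le> ((cube_avg n (p True))\<^sup>2 + (cube_avg n (p False))\<^sup>2) * ((cube_avg n (q True))\<^sup>2 + (cube_avg n (q False))\<^sup>2)"
    unfolding infl by (intro mult_mono square) auto
  also have "\<dots> \<le>
      vote_avg n (\<lambda>x y z. p True x * q True y) + vote_avg n (\<lambda>x y z. p True x * q False y)
    + vote_avg n (\<lambda>x y z. p False x * q True y) + vote_avg n (\<lambda>x y z. p False x * q False y)"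
    using lower[of True True] lower[of True False] lower[of False True] lower[of False False]
    by (simp add: distrib_left distrib_right)
  also have "\<dots> \<le> 36 * vote_avg n (all_equal f g h)"
  proof -
    define R where "R t u v = vote_avg n (\<lambda>x y z. all_equal f g h (x(i := t)) (y(i := u)) (z(i := v)))" for t u v
    have R0: "0 \<le> R t u v" for t u v
      unfolding R_def by (rule vote_avg_nonneg) (rule nn)
    have "6 * R t u v = (N t u v True True False + N t u v False False True + N t u v True False True
      + N t u v True False False + N t u v False True True + N t u v False True False)" for t u v
      unfolding R_def N_def by (subst vote_avg_fix[OF ij(2)]) simp
    then have R: "N t u v True True False + N t u v False False True
      + N t u v True False False + N t u v False True True \<le> 6 * R t u v" for t u v
      using N0[of t u v True False True] N0[of t u v False True False] by (simp only:)
    have "vote_avg n (all_equal f g h) =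
       (R True True False + R False False True + R True False True
      + R True False False + R False True True + R False True False) / 6"
      unfolding R_def by (rule vote_avg_fix[OF ij(1)])
    then have "6 * (R True True False + R False False True + R True False True + R False True False)
        \<le> 36 * vote_avg n (all_equal f g h)"
      using R0[of True False False] R0[of False True True] by (simp add: field_simps)
    moreover note R[of True True False] R[of False False True] R[of True False True] R[of False True False]
      pivot[of True True] pivot[of True False] pivot[of False True] pivot[of False False]
    ultimately show ?thesis
      unfolding not_True_eq_False not_False_eq_True by argo
  qed
  finally show ?thesis by simp
qed

section \<open>Three functions that are rarely equal\<close>

lemma vote_avg_all_equal_rotate: "vote_avg n (all_equal h f g) = vote_avg n (all_equal f g h)"
proof -
  have "all_equal h f g = (\<lambda>x y z. all_equal f g h y z x)"
    by (simp add: all_equal_def fun_eq_iff mult_ac)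
  then show ?thesis using vote_avg_rotate[of n "all_equal f g h"] by simp
qed

lemma vote_avg_product_le_all_equal:
  assumes f: "\<And>x. f x \<in> {0, 1}" and g: "\<And>x. g x \<in> {0, 1}" and h: "\<And>x. h x \<in> {0, 1}"
  shows "vote_avg n (\<lambda>x y z. f x * g y * h z) \<le> vote_avg n (all_equal f g h)"
    and "vote_avg n (\<lambda>x y z. (1 - f x) * (1 - g y) * (1 - h z)) \<le> vote_avg n (all_equal f g h)"
proof -
  have 01: "0 \<le> f x" "0 \<le> 1 - f x" "0 \<le> g x" "0 \<le> 1 - g x" "0 \<le> h x" "0 \<le> 1 - h x" for x
    using f[of x] g[of x] h[of x] by auto
  have "0 \<le> f x * g y * h z" "0 \<le> (1 - f x) * (1 - g y) * (1 - h z)" for x y z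
    by (intro mult_nonneg_nonneg 01)+
  then show "vote_avg n (\<lambda>x y z. f x * g y * h z) \<le> vote_avg n (all_equal f g h)"
    "vote_avg n (\<lambda>x y z. (1 - f x) * (1 - g y) * (1 - h z)) \<le> vote_avg n (all_equal f g h)"
    by (intro vote_avg_mono; simp add: all_equal_def)+
qed

lemma vote_avg_fixed_le:
  assumes "i < n" "\<And>x y z. 0 \<le> \<Phi> x y z" "\<not> (s = t \<and> t = u)"
  shows "vote_avg n (\<lambda>x y z. \<Phi> (x(i := s)) (y(i := t)) (z(i := u))) \<le> 6 * vote_avg n \<Phi>"
proof -
  have nn: "0 \<le> vote_avg n (\<lambda>x y z. \<Phi> (x(i := s)) (y(i := t)) (z(i := u)))" for s t u
    by (rule vote_avg_nonneg) (rule assms)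
  show ?thesis
    unfolding vote_avg_fix[OF assms(1), of \<Phi>] using assms(3)
      nn[of True True False] nn[of False False True] nn[of True False True]
      nn[of True False False] nn[of False True True] nn[of False True False]
    by (cases s; cases t; cases u) simp_all
qed

lemma influence_fixed_self: "influence n i (\<lambda>x. f (x(i := b))) = 0"
  by (simp add: influence_def)

lemma influence_fixed_other:
  assumes "i < n" "i \<noteq> j"
  shows "influence n j (\<lambda>x. f (x(i := b))) \<le> 2 * influence n j f"
proof -
  have swap: "x(j := c, i := b) = x(i := b, j := c)" for x :: bits and b c
    using assms by (simp only: fun_upd_twist)
  have split: "influence n j f = (influence n j (\<lambda>x. f (x(i := True))) + influence n j (\<lambda>x. f (x(i := False)))) / 2"
    unfolding influence_def by (subst cube_avg_fix[OF assms(1)]) (simp only: swap)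
  have "0 \<le> influence n j (\<lambda>x. f (x(i := c)))" for c
    unfolding influence_def by (rule cube_avg_nonneg) simp
  from this[of True] this[of False] show ?thesis unfolding split by (cases b) simp_all
qed

lemma influence_complement: "influence n i (\<lambda>x. 1 - f x) = influence n i f"
  unfolding influence_def by (simp add: abs_minus_commute)

text \<open>
  Rotating the three functions by \<open>vote_avg_all_equal_rotate\<close> gives an influential voter for each.
\<close>

lemma exists_influential_voter:
  assumes bool: "\<And>x. f x \<in> {0, 1}" "\<And>x. g x \<in> {0, 1}" "\<And>x. h x \<in> {0, 1}"
    and mean: "\<eta> \<le> cube_avg n f" "\<eta> \<le> cube_avg n g" "\<eta> \<le> cube_avg n h"
    and \<eta>: "0 \<le> \<eta>" and \<rho>: "0 \<le> \<rho>"
    and small: "vote_avg n (all_equal f g h) < \<eta> ^ 32 - 1000 * \<rho>"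
  shows "\<exists>i<n. \<rho>\<^sup>2 < influence n i h"
proof (rule ccontr)
  assume "\<not> ?thesis"
  then have "influence n i h \<le> 2 * \<rho>\<^sup>2" if "i < n" for i
    using that zero_le_power2[of \<rho>] by (meson dual_order.trans linorder_not_less mult_le_cancel_right1 one_le_numeral)
  from low_influence_lower_bound[of f g h n \<rho> \<eta>, OF bool this \<rho> \<eta> mean] small
    vote_avg_product_le_all_equal(1)[of f g h n, OF bool] show False by linarith
qed

lemma same_influential_voter:
  assumes bool: "\<And>x. f x \<in> {0, 1}" "\<And>x. g x \<in> {0, 1}" "\<And>x. h x \<in> {0, 1}"
    and ij: "i < n" "j < n" "\<rho>\<^sup>2 < influence n i f" "\<rho>\<^sup>2 < influence n j g"
    and small: "vote_avg n (all_equal f g h) \<le> \<rho> ^ 8 / 9"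
  shows "i = j"
proof (rule ccontr)
  assume "i \<noteq> j"
  have "\<rho> ^ 8 = (\<rho>\<^sup>2)\<^sup>2 * (\<rho>\<^sup>2)\<^sup>2" by (simp flip: power_mult power_add)
  also have "\<dots> < (influence n i f)\<^sup>2 * (influence n j g)\<^sup>2"
    using ij by (intro mult_strict_mono' power_strict_mono) auto
  also have "\<dots> / 9 \<le> \<rho> ^ 8 / 9"
    using two_pivotal_voters[of f g h i n j, OF bool ij(1,2) \<open>i \<noteq> j\<close>] small by linarith
  finally show False by simp
qed

text \<open>
  Once the bits of the one influential voter are fixed, no influential voter is left, so the three
  restricted functions can rarely be equal to one only if one of them is rarely one.
\<close>

lemma some_mean_small:
  assumes bool: "\<And>x. f x \<in> {0, 1}" "\<And>x. g x \<in> {0, 1}" "\<And>x. h x \<in> {0, 1}"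
    and i: "i < n" and infl: "\<And>j. j < n \<Longrightarrow> j \<noteq> i \<Longrightarrow> influence n j h \<le> \<rho>\<^sup>2"
    and \<eta>: "0 \<le> \<eta>" and \<rho>: "0 \<le> \<rho>"
    and small: "6 * vote_avg n (\<lambda>x y z. f x * g y * h z) < \<eta> ^ 32 - 1000 * \<rho>"
    and stu: "\<not> (s = t \<and> t = u)"
  shows "cube_avg n (\<lambda>x. f (x(i := s))) < \<eta> \<or> cube_avg n (\<lambda>x. g (x(i := t))) < \<eta>
    \<or> cube_avg n (\<lambda>x. h (x(i := u))) < \<eta>"
proof (rule ccontr)
  assume "\<not> ?thesis"
  then have mean: "\<eta> \<le> cube_avg n (\<lambda>x. f (x(i := s)))" "\<eta> \<le> cube_avg n (\<lambda>x. g (x(i := t)))"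
    "\<eta> \<le> cube_avg n (\<lambda>x. h (x(i := u)))" by auto
  have "influence n j (\<lambda>x. h (x(i := u))) \<le> 2 * \<rho>\<^sup>2" if "j < n" for j
    using influence_fixed_other[OF i, of j h u] infl[OF that] influence_fixed_self[of n i h u]
    by (cases "j = i") auto
  from low_influence_lower_bound[of "\<lambda>x. f (x(i := s))" "\<lambda>x. g (x(i := t))" "\<lambda>x. h (x(i := u))",
      OF bool this \<rho> \<eta> mean]
  have "\<eta> ^ 32 - 1000 * \<rho> \<le> vote_avg n (\<lambda>x y z. f (x(i := s)) * g (y(i := t)) * h (z(i := u)))" .
  also have "\<dots> \<le> 6 * vote_avg n (\<lambda>x y z. f x * g y * h z)"
  proof (rule vote_avg_fixed_le[OF i _ stu])
    show "0 \<le> f x * g y * h z" for x y z using bool(1)[of x] bool(2)[of y] bool(3)[of z] by auto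
  qed
  finally show False using small by simp
qed

lemma dictator_distance:
  assumes f: "\<And>x. f x \<in> {0, 1}" and i: "i < n"
  shows "cube_avg n (\<lambda>x. \<bar>f x - of_bool (x i = s)\<bar>) =
    (1 - cube_avg n (\<lambda>x. f (x(i := s))) + cube_avg n (\<lambda>x. f (x(i := \<not> s)))) / 2"
proof -
  have [simp]: "\<bar>f x\<bar> = f x" "\<bar>f x - 1\<bar> = 1 - f x" for x using f[of x] by auto
  show ?thesis
    by (subst cube_avg_fix[OF i]) (cases s, simp_all add: cube_avg_diff)
qed

text \<open>
  Arrow's theorem for a single voter, with approximate values. If one value were intermediate, say
  \<open>a True\<close>, then the two other functions would have to be opposite extremes for each of the three
  triples compatible with it, which forces one of them to be constant. So all values are
  extreme and each function follows its bit or the negation of it; if the signs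
  were not the same, all three functions would agree on one of the six triples.
\<close>

lemma common_sign_of_means:
  fixes a b c :: "bool \<Rightarrow> real"
  assumes low: "\<And>s t u. \<not> (s = t \<and> t = u) \<Longrightarrow> a s < \<eta> \<or> b t < \<eta> \<or> c u < \<eta>"
    and high: "\<And>s t u. \<not> (s = t \<and> t = u) \<Longrightarrow> 1 - \<eta> < a s \<or> 1 - \<eta> < b t \<or> 1 - \<eta> < c u"
    and \<eta>: "\<eta> \<le> 1/2"
    and mean: "\<And>s. \<eta> \<le> (a s + a (\<not> s)) / 2" "\<And>s. (a s + a (\<not> s)) / 2 \<le> 1 - \<eta>"
      "\<And>s. \<eta> \<le> (b s + b (\<not> s)) / 2" "\<And>s. (b s + b (\<not> s)) / 2 \<le> 1 - \<eta>"
      "\<And>s. \<eta> \<le> (c s + c (\<not> s)) / 2" "\<And>s. (c s + c (\<not> s)) / 2 \<le> 1 - \<eta>"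
  shows "\<exists>s. 1 - \<eta> < a s \<and> a (\<not> s) < \<eta> \<and> 1 - \<eta> < b s \<and> b (\<not> s) < \<eta> \<and> 1 - \<eta> < c s \<and> c (\<not> s) < \<eta>"
proof -
  define L where "L r = (r < \<eta>)" for r
  define U where "U r = (1 - \<eta> < r)" for r
  have LU: "\<not> (L r \<and> U r)" for r using \<eta> by (auto simp: L_def U_def)
  have one: "\<not> (L (a True) \<and> L (a False))" "\<not> (U (a True) \<and> U (a False))"
    "\<not> (L (b True) \<and> L (b False))" "\<not> (U (b True) \<and> U (b False))"
    "\<not> (L (c True) \<and> L (c False))" "\<not> (U (c True) \<and> U (c False))"
    using mean(1)[of True] mean(2)[of True] mean(3)[of True] mean(4)[of True] mean(5)[of True] mean(6)[of True]
    by (auto simp: L_def U_def)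
  note l = low[folded L_def] and u = high[folded U_def]
  have "(U (a True) \<and> L (a False) \<and> U (b True) \<and> L (b False) \<and> U (c True) \<and> L (c False)) \<or>
    (U (a False) \<and> L (a True) \<and> U (b False) \<and> L (b True) \<and> U (c False) \<and> L (c True))"
    using l[of True True False] l[of False False True] l[of True False True] l[of True False False]
      l[of False True True] l[of False True False]
      u[of True True False] u[of False False True] u[of True False True] u[of True False False]
      u[of False True True] u[of False True False] one
      LU[of "a True"] LU[of "a False"] LU[of "b True"] LU[of "b False"] LU[of "c True"] LU[of "c False"]
    by simp argo
  then show ?thesis unfolding L_def U_def by (metis (full_types))
qed

text \<open>
  Each function has an influential voter; by \<open>same_influential_voter\<close> it is the same voter \<open>i\<close> for
  all three, and no other voter is influential for any of them. The six rankings of \<open>i\<close> then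
  determine the outcomes up to a small error.
\<close>

lemma close_to_common_dictator:
  assumes bool: "\<And>x. f x \<in> {0, 1}" "\<And>x. g x \<in> {0, 1}" "\<And>x. h x \<in> {0, 1}"
    and \<eta>: "0 < \<eta>" "\<eta> \<le> 1/2"
    and mean: "\<eta> \<le> cube_avg n f" "cube_avg n f \<le> 1 - \<eta>" "\<eta> \<le> cube_avg n g" "cube_avg n g \<le> 1 - \<eta>"
      "\<eta> \<le> cube_avg n h" "cube_avg n h \<le> 1 - \<eta>"
    and small: "vote_avg n (all_equal f g h) \<le> (\<eta> ^ 32 / 2000) ^ 8 / 9"
  obtains i s where "i < n" "cube_avg n (\<lambda>x. \<bar>f x - of_bool (x i = s)\<bar>) \<le> \<eta>"
    "cube_avg n (\<lambda>x. \<bar>g x - of_bool (x i = s)\<bar>) \<le> \<eta>" "cube_avg n (\<lambda>x. \<bar>h x - of_bool (x i = s)\<bar>) \<le> \<eta>"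
proof -
  \<comment> \<open>the error \<open>1000 * \<rho>\<close> of \<open>low_influence_lower_bound\<close> uses up half of its main term\<close>
  define \<rho> where "\<rho> = \<eta> ^ 32 / 2000"
  have \<rho>: "0 < \<rho>" "\<rho> \<le> 1"
  proof -
    have "\<eta> ^ 32 \<le> 1" using \<eta> by (intro power_le_one) auto
    then show "0 < \<rho>" "\<rho> \<le> 1" using \<eta> by (simp_all add: \<rho>_def)
  qed
  have Q: "vote_avg n (all_equal f g h) \<le> \<rho> ^ 8 / 9" using small by (simp add: \<rho>_def)
  have rot1: "vote_avg n (all_equal g h f) = vote_avg n (all_equal f g h)"
    using vote_avg_all_equal_rotate[of n f g h] by simp
  have rot2: "vote_avg n (all_equal h f g) = vote_avg n (all_equal f g h)"
    by (rule vote_avg_all_equal_rotate)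
  have "\<rho> ^ 8 \<le> \<rho>" using power_decreasing[of 1 8 \<rho>] \<rho> by simp
  then have gap: "6 * vote_avg n (all_equal f g h) < \<eta> ^ 32 - 1000 * \<rho>"
  proof -
    have "\<eta> ^ 32 = 2000 * \<rho>" by (simp add: \<rho>_def)
    then show ?thesis using Q \<rho> \<open>\<rho> ^ 8 \<le> \<rho>\<close> by linarith
  qed
  have nn: "0 \<le> vote_avg n (all_equal f g h)"
  proof (rule vote_avg_nonneg)
    show "0 \<le> all_equal f g h x y z" for x y z
      using bool(1)[of x] bool(2)[of y] bool(3)[of z] by (auto simp: all_equal_def)
  qed
  have gap1: "vote_avg n (all_equal f g h) < \<eta> ^ 32 - 1000 * \<rho>" using gap nn by linarith
  obtain i where i: "i < n" "\<rho>\<^sup>2 < influence n i f"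
    using exists_influential_voter[of g h f \<eta> n \<rho>, OF bool(2,3,1) mean(3,5,1)] gap1 \<eta> \<rho> by (auto simp: rot1)
  obtain j where j: "j < n" "\<rho>\<^sup>2 < influence n j g"
    using exists_influential_voter[of h f g \<eta> n \<rho>, OF bool(3,1,2) mean(5,1,3)] gap1 \<eta> \<rho> by (auto simp: rot2)
  have fg: "i' = j'" if "i' < n" "j' < n" "\<rho>\<^sup>2 < influence n i' f" "\<rho>\<^sup>2 < influence n j' g" for i' j'
    using same_influential_voter[of f g h i' n j' \<rho>, OF bool that Q] .
  have gh: "i' = j'" if "i' < n" "j' < n" "\<rho>\<^sup>2 < influence n i' g" "\<rho>\<^sup>2 < influence n j' h" for i' j'
    using same_influential_voter[of g h f i' n j' \<rho>, OF bool(2,3,1) that] Q rot1 by simp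
  have ij: "i = j" using fg i j by blast
  have only: "influence n j' f \<le> \<rho>\<^sup>2" "influence n j' g \<le> \<rho>\<^sup>2" "influence n j' h \<le> \<rho>\<^sup>2"
    if "j' < n" "j' \<noteq> i" for j'
    using fg[of j' j] fg[of i j'] gh[of j j'] i j ij that by force+
  have cf: "(1 - f x) \<in> {0, 1}" "(1 - g x) \<in> {0, 1}" "(1 - h x) \<in> {0, 1}" for x
    using bool(1)[of x] bool(2)[of x] bool(3)[of x] by auto
  have "\<exists>s. 1 - \<eta> < cube_avg n (\<lambda>x. f (x(i := s))) \<and> cube_avg n (\<lambda>x. f (x(i := \<not> s))) < \<eta>
    \<and> 1 - \<eta> < cube_avg n (\<lambda>x. g (x(i := s))) \<and> cube_avg n (\<lambda>x. g (x(i := \<not> s))) < \<eta>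
    \<and> 1 - \<eta> < cube_avg n (\<lambda>x. h (x(i := s))) \<and> cube_avg n (\<lambda>x. h (x(i := \<not> s))) < \<eta>"
  proof (rule common_sign_of_means)
    fix s t u :: bool assume stu: "\<not> (s = t \<and> t = u)"
    show "cube_avg n (\<lambda>x. f (x(i := s))) < \<eta> \<or> cube_avg n (\<lambda>x. g (x(i := t))) < \<eta>
        \<or> cube_avg n (\<lambda>x. h (x(i := u))) < \<eta>"
      using some_mean_small[of f g h i n \<rho> \<eta> s t u, OF bool i(1) only(3) _ _ _ stu] gap \<eta> \<rho>
        vote_avg_product_le_all_equal(1)[of f g h n, OF bool] by simp
    show "1 - \<eta> < cube_avg n (\<lambda>x. f (x(i := s))) \<or> 1 - \<eta> < cube_avg n (\<lambda>x. g (x(i := t)))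
        \<or> 1 - \<eta> < cube_avg n (\<lambda>x. h (x(i := u)))"
      using some_mean_small[of "\<lambda>x. 1 - f x" "\<lambda>x. 1 - g x" "\<lambda>x. 1 - h x" i n \<rho> \<eta> s t u,
          OF cf i(1) _ _ _ _ stu] gap \<eta> \<rho> only(3)
        vote_avg_product_le_all_equal(2)[of f g h n, OF bool]
      by (simp add: influence_complement cube_avg_diff) linarith
  next
    fix s
    have "(cube_avg n (\<lambda>x. w (x(i := s))) + cube_avg n (\<lambda>x. w (x(i := \<not> s)))) / 2 = cube_avg n w" for w
      unfolding cube_avg_fix[OF i(1), of w] by (cases s) simp_all
    then show "\<eta> \<le> (cube_avg n (\<lambda>x. f (x(i := s))) + cube_avg n (\<lambda>x. f (x(i := \<not> s)))) / 2"
      "(cube_avg n (\<lambda>x. f (x(i := s))) + cube_avg n (\<lambda>x. f (x(i := \<not> s)))) / 2 \<le> 1 - \<eta>"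
      "\<eta> \<le> (cube_avg n (\<lambda>x. g (x(i := s))) + cube_avg n (\<lambda>x. g (x(i := \<not> s)))) / 2"
      "(cube_avg n (\<lambda>x. g (x(i := s))) + cube_avg n (\<lambda>x. g (x(i := \<not> s)))) / 2 \<le> 1 - \<eta>"
      "\<eta> \<le> (cube_avg n (\<lambda>x. h (x(i := s))) + cube_avg n (\<lambda>x. h (x(i := \<not> s)))) / 2"
      "(cube_avg n (\<lambda>x. h (x(i := s))) + cube_avg n (\<lambda>x. h (x(i := \<not> s)))) / 2 \<le> 1 - \<eta>"
      using mean by simp_all
  qed (use \<eta> in simp)
  then obtain s where s: "1 - \<eta> < cube_avg n (\<lambda>x. f (x(i := s)))" "cube_avg n (\<lambda>x. f (x(i := \<not> s))) < \<eta>"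
    "1 - \<eta> < cube_avg n (\<lambda>x. g (x(i := s)))" "cube_avg n (\<lambda>x. g (x(i := \<not> s))) < \<eta>"
    "1 - \<eta> < cube_avg n (\<lambda>x. h (x(i := s)))" "cube_avg n (\<lambda>x. h (x(i := \<not> s))) < \<eta>" by blast
  show ?thesis
    by (rule that[OF i(1), of s]) (use s in \<open>simp_all add: dictator_distance[of f, OF bool(1) i(1)]
        dictator_distance[of g, OF bool(2) i(1)] dictator_distance[of h, OF bool(3) i(1)]\<close>)
qed

section \<open>Uniformly random rankings\<close>

definition swap_alternatives :: "nat \<Rightarrow> nat \<Rightarrow> nat rel \<Rightarrow> nat rel" where
  "swap_alternatives u v r = {(p, q). (Transposition.transpose u v p, Transposition.transpose u v q) \<in> r}"

lemma swap_alternatives_iff: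
  "(p, q) \<in> swap_alternatives u v r \<longleftrightarrow> (Transposition.transpose u v p, Transposition.transpose u v q) \<in> r"
  by (simp add: swap_alternatives_def)

lemma swap_alternatives_twice [simp]: "swap_alternatives u v (swap_alternatives u v r) = r"
  by (simp add: swap_alternatives_def)

lemma swap_alternatives_rankings:
  assumes "u < k" "v < k" "r \<in> rankings k"
  shows "swap_alternatives u v r \<in> rankings k"
proof -
  let ?t = "Transposition.transpose u v"
  have t: "?t p < k \<longleftrightarrow> p < k" for p using assms(1,2) by (auto simp: Transposition.transpose_def)
  have r: "r \<subseteq> {..<k} \<times> {..<k}" "trans r" "irrefl r" "total_on {..<k} r"
    using assms(3) by (simp_all add: rankings_def strict_linear_order_on_def)
  have "swap_alternatives u v r \<subseteq> {..<k} \<times> {..<k}"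
    using r(1) t by (auto simp: swap_alternatives_def)
  moreover have "trans (swap_alternatives u v r)"
    using r(2) by (auto simp: swap_alternatives_def trans_def)
  moreover have "irrefl (swap_alternatives u v r)"
    using r(3) by (auto simp: swap_alternatives_def irrefl_def)
  moreover have "total_on {..<k} (swap_alternatives u v r)"
    using r(4) t unfolding total_on_def swap_alternatives_iff
    by (metis lessThan_iff transpose_eq_iff)
  ultimately show ?thesis by (simp add: rankings_def strict_linear_order_on_def)
qed

lemma card_rankings_swap:
  assumes "u < k" "v < k"
  shows "card {r \<in> rankings k. P r} = card {r \<in> rankings k. P (swap_alternatives u v r)}"
  by (rule bij_betw_same_card[of "swap_alternatives u v"], rule bij_betw_byWitness[of _ "swap_alternatives u v"])
    (use assms swap_alternatives_rankings in auto)

lemma ranking_reverse_iff: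
  assumes "r \<in> rankings k" "p < k" "q < k" "p \<noteq> q"
  shows "(q, p) \<in> r \<longleftrightarrow> (p, q) \<notin> r"
proof -
  have r: "trans r" "irrefl r" "total_on {..<k} r"
    using assms(1) by (simp_all add: rankings_def strict_linear_order_on_def)
  have "(p, q) \<in> r \<or> (q, p) \<in> r" using r(3) assms(2-4) by (simp add: total_on_def)
  moreover have "\<not> ((p, q) \<in> r \<and> (q, p) \<in> r)" using r(1,2) by (meson irrefl_def transD)
  ultimately show ?thesis by blast
qed

text \<open>
  Exchanging two of the three alternatives permutes the rankings, and these exchanges act transitively
  on the six relative orders of \<open>a\<close>, \<open>b\<close>, \<open>c\<close>. Hence all six orders are equally frequent.
\<close>

lemma sum_rankings:
  fixes W :: "bool \<Rightarrow> bool \<Rightarrow> bool \<Rightarrow> real"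
  assumes abc: "a < k" "b < k" "c < k" "a \<noteq> b" "b \<noteq> c" "c \<noteq> a"
  shows "(\<Sum>r\<in>rankings k. W ((a, b) \<in> r) ((b, c) \<in> r) ((c, a) \<in> r)) =
    real (card (rankings k)) * ((W True True False + W False False True + W True False True
      + W True False False + W False True True + W False True False) / 6)"
proof -
  define N where "N s t u = card {r \<in> rankings k. ((a, b) \<in> r) = s \<and> ((b, c) \<in> r) = t \<and> ((c, a) \<in> r) = u}" for s t u
  have rev: "(b, a) \<in> r \<longleftrightarrow> (a, b) \<notin> r" "(c, b) \<in> r \<longleftrightarrow> (b, c) \<notin> r" "(a, c) \<in> r \<longleftrightarrow> (c, a) \<notin> r"
    if "r \<in> rankings k" for r
    by (rule ranking_reverse_iff[OF that]; use abc in simp)+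
  have ab: "N s t u = N (\<not> s) (\<not> u) (\<not> t)" for s t u
  proof -
    have swap: "(a, b) \<in> swap_alternatives a b r \<longleftrightarrow> (b, a) \<in> r" "(b, c) \<in> swap_alternatives a b r \<longleftrightarrow> (a, c) \<in> r"
      "(c, a) \<in> swap_alternatives a b r \<longleftrightarrow> (c, b) \<in> r" for r
      using abc by (simp_all add: swap_alternatives_iff Transposition.transpose_def)
    show ?thesis
      unfolding N_def by (subst card_rankings_swap[OF abc(1,2)], rule arg_cong[where f = card])
        (use rev in \<open>fastforce simp: swap\<close>)
  qed
  have bc: "N s t u = N (\<not> u) (\<not> t) (\<not> s)" for s t u
  proof -
    have swap: "(a, b) \<in> swap_alternatives b c r \<longleftrightarrow> (a, c) \<in> r" "(b, c) \<in> swap_alternatives b c r \<longleftrightarrow> (c, b) \<in> r"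
      "(c, a) \<in> swap_alternatives b c r \<longleftrightarrow> (b, a) \<in> r" for r
      using abc by (simp_all add: swap_alternatives_iff Transposition.transpose_def)
    show ?thesis
      unfolding N_def by (subst card_rankings_swap[OF abc(2,3)], rule arg_cong[where f = card])
        (use rev in \<open>fastforce simp: swap\<close>)
  qed
  have eq: "N False False True = N True True False" "N True False True = N True True False"
    "N True False False = N True True False" "N False True True = N True True False"
    "N False True False = N True True False"
    using ab[of True True False] bc[of True True False] ab[of True False False] bc[of False True False]
      ab[of False True True] bc[of False True True] ab[of False False True] bc[of False False True]
    unfolding not_True_eq_False not_False_eq_True by linarith+
  have sum_W: "(\<Sum>r\<in>rankings k. W' ((a, b) \<in> r) ((b, c) \<in> r) ((c, a) \<in> r)) =
      real (N True True False) * (W' True True False + W' False False True + W' True False True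
      + W' True False False + W' False True True + W' False True False)" for W' :: "bool \<Rightarrow> bool \<Rightarrow> bool \<Rightarrow> real"
  proof -
    define I where "I s t u r = (of_bool (((a, b) \<in> r) = s \<and> ((b, c) \<in> r) = t \<and> ((c, a) \<in> r) = u) :: real)" for s t u r
    have sumI: "(\<Sum>r\<in>rankings k. I s t u r) = real (N s t u)" for s t u
      unfolding I_def N_def using finite_rankings by (simp add: of_bool_def sum.If_cases Int_def)
    have "(\<Sum>r\<in>rankings k. W' ((a, b) \<in> r) ((b, c) \<in> r) ((c, a) \<in> r)) =
      (\<Sum>r\<in>rankings k. I True True False r * W' True True False + I False False True r * W' False False True
       + I True False True r * W' True False True + I True False False r * W' True False False
       + I False True True r * W' False True True + I False True False r * W' False True False)"
    proof (rule sum.cong[OF refl])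
      fix r assume r: "r \<in> rankings k"
      then have tr: "trans r" by (simp add: rankings_def strict_linear_order_on_def)
      have "\<not> ((a, b) \<in> r \<and> (b, c) \<in> r \<and> (c, a) \<in> r)"
        using tr rev[OF r] by (meson transD)
      moreover have "\<not> ((a, b) \<notin> r \<and> (b, c) \<notin> r \<and> (c, a) \<notin> r)"
        using tr rev[OF r] by (meson transD)
      ultimately show "W' ((a, b) \<in> r) ((b, c) \<in> r) ((c, a) \<in> r) =
       I True True False r * W' True True False + I False False True r * W' False False True
       + I True False True r * W' True False True + I True False False r * W' True False False
       + I False True True r * W' False True True + I False True False r * W' False True False"
        by (auto simp: I_def)
    qed
    also have "\<dots> = real (N True True False) * W' True True False + real (N False False True) * W' False False True
       + real (N True False True) * W' True False True + real (N True False False) * W' True False False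
       + real (N False True True) * W' False True True + real (N False True False) * W' False True False"
      by (simp add: sum.distrib sumI flip: sum_distrib_right)
    finally show ?thesis by (simp add: eq distrib_left)
  qed
  show ?thesis using sum_W[of W] sum_W[of "\<lambda>_ _ _. 1"] by simp
qed

text \<open>The bits vanish from \<open>n\<close> on, as in the base cases of \<open>cube_avg\<close> and \<open>vote_avg\<close>.\<close>

definition pair_votes :: "nat \<Rightarrow> nat \<Rightarrow> nat \<Rightarrow> (nat \<Rightarrow> nat rel) \<Rightarrow> bits" where
  "pair_votes n a b \<sigma> = (\<lambda>i. i < n \<and> (a, b) \<in> \<sigma> i)"

lemma pair_votes_Suc: "pair_votes (Suc n) a b (\<sigma>(n := r)) = (pair_votes n a b \<sigma>)(n := (a, b) \<in> r)"
  by (auto simp: pair_votes_def fun_eq_iff less_Suc_eq)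

lemma finite_profiles: "finite (profiles n k)"
  unfolding profiles_def by (intro finite_PiE) (simp_all add: finite_rankings)

lemma expectation_random_profile:
  assumes abc: "a < k" "b < k" "c < k" "a \<noteq> b" "b \<noteq> c" "c \<noteq> a"
  shows "measure_pmf.expectation (random_profile n k)
    (\<lambda>\<sigma>. \<Phi> (pair_votes n a b \<sigma>) (pair_votes n b c \<sigma>) (pair_votes n c a \<sigma>)) = vote_avg n \<Phi>"
proof (induction n arbitrary: \<Phi>)
  case 0
  show ?case by (simp add: random_profile_def pair_votes_def)
next
  case (Suc n)
  define W where "W s t u = vote_avg n (\<lambda>x y z. \<Phi> (x(n := s)) (y(n := t)) (z(n := u)))" for s t u
  have bind: "random_profile (Suc n) k = pmf_of_set (rankings k) \<bind>
      (\<lambda>r. map_pmf (\<lambda>\<sigma>. \<sigma>(n := r)) (random_profile n k))"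
    unfolding random_profile_def lessThan_Suc
    by (subst Pi_pmf_insert') (simp_all add: map_pmf_def)
  have IH: "measure_pmf.expectation (random_profile n k) (\<lambda>\<sigma>. \<Phi> ((pair_votes n a b \<sigma>)(n := (a, b) \<in> r))
      ((pair_votes n b c \<sigma>)(n := (b, c) \<in> r)) ((pair_votes n c a \<sigma>)(n := (c, a) \<in> r))) =
    W ((a, b) \<in> r) ((b, c) \<in> r) ((c, a) \<in> r)" for r
    unfolding W_def by (rule Suc.IH)
  have "measure_pmf.expectation (random_profile (Suc n) k)
      (\<lambda>\<sigma>. \<Phi> (pair_votes (Suc n) a b \<sigma>) (pair_votes (Suc n) b c \<sigma>) (pair_votes (Suc n) c a \<sigma>)) =
    (\<Sum>r\<in>rankings k. W ((a, b) \<in> r) ((b, c) \<in> r) ((c, a) \<in> r)) / real (card (rankings k))"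
    unfolding bind by (subst pmf_expectation_bind_pmf_of_set)
      (simp_all add: finite_rankings rankings_nonempty set_pmf_random_profile finite_profiles
        pair_votes_Suc IH divide_inverse_commute sum_distrib_left)
  also have "\<dots> = vote_avg (Suc n) \<Phi>"
    unfolding sum_rankings[OF abc] using rankings_nonempty[of k] finite_rankings[of k]
    by (simp add: W_def card_gt_0_iff)
  finally show ?case .
qed

section \<open>Constitutions\<close>

text \<open>
  The function through which the votes on \<open>a\<close> and \<open>b\<close> determine the outcome on this pair, by IIA. Bit
  vectors that come from no profile get the value zero.
\<close>

definition pair_outcome :: "nat \<Rightarrow> nat \<Rightarrow> ((nat \<Rightarrow> nat rel) \<Rightarrow> nat rel) \<Rightarrow> nat \<Rightarrow> nat \<Rightarrow> bits \<Rightarrow> real" where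
  "pair_outcome n k F a b x = of_bool (\<exists>\<sigma>\<in>profiles n k. pair_votes n a b \<sigma> = x \<and> (a, b) \<in> F \<sigma>)"

lemma pair_outcome_bool: "pair_outcome n k F a b x \<in> {0, 1}"
proof -
  have "(of_bool P :: real) \<in> {0, 1}" for P by (cases P) simp_all
  then show ?thesis unfolding pair_outcome_def .
qed

lemma pair_outcome_votes:
  assumes "IIA n k F" "a < k" "b < k" "a \<noteq> b" "\<sigma> \<in> profiles n k"
  shows "pair_outcome n k F a b (pair_votes n a b \<sigma>) = of_bool ((a, b) \<in> F \<sigma>)"
proof -
  have "(a, b) \<in> F \<tau> \<longleftrightarrow> (a, b) \<in> F \<sigma>" if "\<tau> \<in> profiles n k" "pair_votes n a b \<tau> = pair_votes n a b \<sigma>" for \<tau>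
  proof -
    have "\<forall>i<n. (a, b) \<in> \<tau> i \<longleftrightarrow> (a, b) \<in> \<sigma> i"
      using fun_cong[OF that(2)] by (auto simp: pair_votes_def)
    then show ?thesis using assms that(1) unfolding IIA_def by blast
  qed
  then have "(\<exists>\<tau>\<in>profiles n k. pair_votes n a b \<tau> = pair_votes n a b \<sigma> \<and> (a, b) \<in> F \<tau>) \<longleftrightarrow> (a, b) \<in> F \<sigma>"
    using assms(5) by blast
  then show ?thesis unfolding pair_outcome_def by (rule arg_cong)
qed

lemma prob_random_profile:
  assumes abc: "a < k" "b < k" "c < k" "a \<noteq> b" "b \<noteq> c" "c \<noteq> a"
    and R: "\<And>\<sigma>. \<sigma> \<in> profiles n k \<Longrightarrow> P \<sigma> \<longleftrightarrow> R (pair_votes n a b \<sigma>) (pair_votes n b c \<sigma>) (pair_votes n c a \<sigma>)"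
  shows "measure_pmf.prob (random_profile n k) {\<sigma>. P \<sigma>} = vote_avg n (\<lambda>x y z. of_bool (R x y z))"
proof -
  let ?R = "{\<sigma>. R (pair_votes n a b \<sigma>) (pair_votes n b c \<sigma>) (pair_votes n c a \<sigma>)}"
  have "{\<sigma>. P \<sigma>} \<inter> set_pmf (random_profile n k) = ?R \<inter> set_pmf (random_profile n k)"
    using R by (auto simp: set_pmf_random_profile)
  from arg_cong[OF this, of "measure_pmf.prob (random_profile n k)"]
  have "measure_pmf.prob (random_profile n k) {\<sigma>. P \<sigma>} = measure_pmf.prob (random_profile n k) ?R"
    unfolding measure_Int_set_pmf .
  also have "\<dots> = measure_pmf.expectation (random_profile n k) (indicator ?R)" by simp
  also have "indicator ?R = (\<lambda>\<sigma>. of_bool (R (pair_votes n a b \<sigma>) (pair_votes n b c \<sigma>) (pair_votes n c a \<sigma>)) :: real)"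
    by (auto simp: indicator_def fun_eq_iff)
  also have "measure_pmf.expectation (random_profile n k) \<dots> = vote_avg n (\<lambda>x y z. of_bool (R x y z))"
    by (rule expectation_random_profile[OF abc])
  finally show ?thesis .
qed

lemma prob_pair_votes:
  assumes "3 \<le> k" "a < k" "b < k" "a \<noteq> b"
    and R: "\<And>\<sigma>. \<sigma> \<in> profiles n k \<Longrightarrow> P \<sigma> \<longleftrightarrow> R (pair_votes n a b \<sigma>)"
  shows "measure_pmf.prob (random_profile n k) {\<sigma>. P \<sigma>} = cube_avg n (\<lambda>x. of_bool (R x))"
proof -
  have "card {a, b} < card {..<k}" using assms by simp
  then have "\<not> {..<k} \<subseteq> {a, b}" using card_mono[of "{a, b}" "{..<k}"] by auto
  then obtain c where c: "c < k" "b \<noteq> c" "c \<noteq> a" by auto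
  have "measure_pmf.prob (random_profile n k) {\<sigma>. P \<sigma>} = vote_avg n (\<lambda>x y z. of_bool (R x))"
    by (rule prob_random_profile[OF assms(2,3) c(1) assms(4) c(2,3)]) (rule R)
  then show ?thesis by (simp only: vote_avg_first)
qed

lemma outcome_reverse_iff:
  assumes "constitution n k F" "\<sigma> \<in> profiles n k" "a < k" "b < k" "a \<noteq> b"
  shows "(b, a) \<in> F \<sigma> \<longleftrightarrow> (a, b) \<notin> F \<sigma>"
proof -
  have "asym (F \<sigma>)" "total_on {..<k} (F \<sigma>)" using assms by (simp_all add: constitution_def)
  then have "(a, b) \<in> F \<sigma> \<or> (b, a) \<in> F \<sigma>" "\<not> ((a, b) \<in> F \<sigma> \<and> (b, a) \<in> F \<sigma>)"
    using assms(3-5) by (auto simp: total_on_def asym_iff)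
  then show ?thesis by blast
qed

lemma vote_ranking: "\<sigma> \<in> profiles n k \<Longrightarrow> i < n \<Longrightarrow> \<sigma> i \<in> rankings k"
  using PiE_mem[of \<sigma> "{..<n}" "\<lambda>_. rankings k" i] by (simp add: profiles_def)

lemma vote_reverse_iff:
  assumes "\<sigma> \<in> profiles n k" "i < n" "a < k" "b < k" "a \<noteq> b"
  shows "(b, a) \<in> \<sigma> i \<longleftrightarrow> (a, b) \<notin> \<sigma> i"
  by (rule ranking_reverse_iff[OF vote_ranking[OF assms(1,2)] assms(3-5)])

lemma prob_cycle_le:
  assumes F: "constitution n k F" "IIA n k F"
    and abc: "a < k" "b < k" "c < k" "a \<noteq> b" "b \<noteq> c" "c \<noteq> a"
  shows "vote_avg n (all_equal (pair_outcome n k F a b) (pair_outcome n k F b c) (pair_outcome n k F c a))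
    \<le> prob_nontransitive n k F"
proof -
  let ?P = "\<lambda>\<sigma>. ((a, b) \<in> F \<sigma>) = ((b, c) \<in> F \<sigma>) \<and> ((b, c) \<in> F \<sigma>) = ((c, a) \<in> F \<sigma>)"
  let ?f = "pair_outcome n k F a b" and ?g = "pair_outcome n k F b c" and ?h = "pair_outcome n k F c a"
  have "all_equal ?f ?g ?h x y z = of_bool (?f x = ?g y \<and> ?g y = ?h z)" for x y z
    using pair_outcome_bool[of n k F a b x] pair_outcome_bool[of n k F b c y] pair_outcome_bool[of n k F c a z]
    by (auto simp: all_equal_def)
  then have "vote_avg n (all_equal ?f ?g ?h) = vote_avg n (\<lambda>x y z. of_bool (?f x = ?g y \<and> ?g y = ?h z))"
    by presburger
  also have "\<dots> = measure_pmf.prob (random_profile n k) {\<sigma>. ?P \<sigma>}"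
  proof (rule prob_random_profile[OF abc, symmetric])
    fix \<sigma> assume \<sigma>: "\<sigma> \<in> profiles n k"
    show "?P \<sigma> \<longleftrightarrow> ?f (pair_votes n a b \<sigma>) = ?g (pair_votes n b c \<sigma>)
        \<and> ?g (pair_votes n b c \<sigma>) = ?h (pair_votes n c a \<sigma>)"
      unfolding pair_outcome_votes[OF F(2) abc(1,2,4) \<sigma>] pair_outcome_votes[OF F(2) abc(2,3,5) \<sigma>]
        pair_outcome_votes[OF F(2) abc(3,1,6) \<sigma>] of_bool_eq_iff ..
  qed
  also have "\<dots> = measure_pmf.prob (random_profile n k) ({\<sigma>. ?P \<sigma>} \<inter> profiles n k)"
    by (simp only: set_pmf_random_profile[symmetric] measure_Int_set_pmf)
  also have "\<dots> \<le> measure_pmf.prob (random_profile n k) {\<sigma>. \<not> trans (F \<sigma>)}"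
  proof (rule measure_pmf.finite_measure_mono)
    show "{\<sigma>. ?P \<sigma>} \<inter> profiles n k \<subseteq> {\<sigma>. \<not> trans (F \<sigma>)}"
    proof clarify
      fix \<sigma> assume \<sigma>: "\<sigma> \<in> profiles n k" "trans (F \<sigma>)"
        and eq: "((a, b) \<in> F \<sigma>) = ((b, c) \<in> F \<sigma>)" "((b, c) \<in> F \<sigma>) = ((c, a) \<in> F \<sigma>)"
      note rev = outcome_reverse_iff[OF F(1) \<sigma>(1)]
      have "(b, a) \<in> F \<sigma> \<longleftrightarrow> (a, b) \<notin> F \<sigma>" "(c, b) \<in> F \<sigma> \<longleftrightarrow> (b, c) \<notin> F \<sigma>" "(a, c) \<in> F \<sigma> \<longleftrightarrow> (c, a) \<notin> F \<sigma>"
        by (rule rev; use abc in simp)+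
      then show False using eq transD[OF \<sigma>(2), of a b c] transD[OF \<sigma>(2), of a c b] by blast
    qed
  qed simp
  finally show ?thesis by (simp add: prob_nontransitive_def)
qed

text \<open>
  This makes the dictator close to a given pair unique, so that different triples of alternatives
  which share a pair have the same dictator.
\<close>

lemma distinct_dictators_far:
  assumes "i < n" "j < n" "(i, s) \<noteq> (j, t)"
  shows "1/2 \<le> cube_avg n (\<lambda>x. \<bar>of_bool (x i = s) - of_bool (x j = t)\<bar>)"
proof -
  have eq: "cube_avg n (\<lambda>x. \<bar>of_bool (x i = s) - of_bool (x j = t)\<bar>) =
      (1 - cube_avg n (\<lambda>x. of_bool ((x(j := t)) i = s)) + cube_avg n (\<lambda>x. of_bool ((x(j := \<not> t)) i = s))) / 2"
    by (rule dictator_distance[OF _ assms(2)]) (simp add: of_bool_def)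
  show ?thesis unfolding eq using assms(3) by (cases "i = j") auto
qed

lemma dictator_unique:
  assumes "i < n" "j < n" "\<epsilon> < 1/4"
    and "cube_avg n (\<lambda>x. \<bar>f x - of_bool (x i = s)\<bar>) \<le> \<epsilon>" "cube_avg n (\<lambda>x. \<bar>f x - of_bool (x j = t)\<bar>) \<le> \<epsilon>"
  shows "i = j \<and> s = t"
proof (rule ccontr)
  assume "\<not> ?thesis"
  then have "1/2 \<le> cube_avg n (\<lambda>x. \<bar>of_bool (x i = s) - of_bool (x j = t)\<bar>)"
    using distinct_dictators_far[OF assms(1,2), of s t] by auto
  also have "\<dots> \<le> cube_avg n (\<lambda>x. \<bar>f x - of_bool (x i = s)\<bar> + \<bar>f x - of_bool (x j = t)\<bar>)"
    by (rule cube_avg_mono) linarith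
  also have "\<dots> < 1/2" using assms(3-5) by (simp add: cube_avg_add)
  finally show False by simp
qed

definition pair_distance :: "nat \<Rightarrow> nat \<Rightarrow> ((nat \<Rightarrow> nat rel) \<Rightarrow> nat rel) \<Rightarrow> nat \<Rightarrow> bool \<Rightarrow> nat \<Rightarrow> nat \<Rightarrow> real" where
  "pair_distance n k F i s a b =
     measure_pmf.prob (random_profile n k) {\<sigma>. ((a, b) \<in> F \<sigma>) \<noteq> (((a, b) \<in> \<sigma> i) = s)}"

lemma pair_distance_eq:
  assumes "3 \<le> k" "IIA n k F" "i < n" "a < k" "b < k" "a \<noteq> b"
  shows "pair_distance n k F i s a b = cube_avg n (\<lambda>x. \<bar>pair_outcome n k F a b x - of_bool (x i = s)\<bar>)"
proof -
  have "pair_distance n k F i s a b = cube_avg n (\<lambda>x. of_bool (pair_outcome n k F a b x \<noteq> of_bool (x i = s)))"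
    unfolding pair_distance_def
  proof (rule prob_pair_votes[OF assms(1,4-6)])
    fix \<sigma> assume \<sigma>: "\<sigma> \<in> profiles n k"
    have "pair_votes n a b \<sigma> i = ((a, b) \<in> \<sigma> i)" using assms(3) by (simp add: pair_votes_def)
    then show "((a, b) \<in> F \<sigma>) \<noteq> (((a, b) \<in> \<sigma> i) = s) \<longleftrightarrow>
        pair_outcome n k F a b (pair_votes n a b \<sigma>) \<noteq> of_bool (pair_votes n a b \<sigma> i = s)"
      unfolding pair_outcome_votes[OF assms(2,4-6) \<sigma>] of_bool_eq_iff by simp
  qed
  also have "(\<lambda>x. of_bool (pair_outcome n k F a b x \<noteq> of_bool (x i = s))) =
      (\<lambda>x. \<bar>pair_outcome n k F a b x - of_bool (x i = s)\<bar>)"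
    by (auto simp: fun_eq_iff pair_outcome_def)
  finally show ?thesis .
qed

lemma pair_distance_sym:
  assumes "constitution n k F" "i < n" "a < k" "b < k" "a \<noteq> b"
  shows "pair_distance n k F i s b a = pair_distance n k F i s a b"
proof -
  have "{\<sigma>. ((b, a) \<in> F \<sigma>) \<noteq> (((b, a) \<in> \<sigma> i) = s)} \<inter> set_pmf (random_profile n k) =
      {\<sigma>. ((a, b) \<in> F \<sigma>) \<noteq> (((a, b) \<in> \<sigma> i) = s)} \<inter> set_pmf (random_profile n k)"
    unfolding set_pmf_random_profile
    using outcome_reverse_iff[OF assms(1) _ assms(3-5)] vote_reverse_iff[OF _ assms(2-5)] by blast
  from arg_cong[OF this, of "measure_pmf.prob (random_profile n k)"] show ?thesis
    unfolding pair_distance_def measure_Int_set_pmf .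
qed

text \<open>A union bound over the pairs of alternatives, of which there are at most \<open>k\<^sup>2\<close>.\<close>

lemma disagreement_le:
  assumes F: "constitution n k F" and i: "i < n"
    and close: "\<And>a b. a < k \<Longrightarrow> b < k \<Longrightarrow> a \<noteq> b \<Longrightarrow> pair_distance n k F i s a b \<le> \<epsilon>" and \<epsilon>: "0 \<le> \<epsilon>"
  shows "disagreement n k F (\<lambda>\<sigma>. if s then \<sigma> i else (\<sigma> i)\<inverse>) \<le> (real k)\<^sup>2 * \<epsilon>"
proof -
  let ?G = "\<lambda>\<sigma>. if s then \<sigma> i else (\<sigma> i)\<inverse>"
  let ?I = "{(a, b). a < k \<and> b < k \<and> a \<noteq> b}"
  let ?E = "\<lambda>(a, b). {\<sigma>. ((a, b) \<in> F \<sigma>) \<noteq> (((a, b) \<in> \<sigma> i) = s)}"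
  have I: "?I \<subseteq> {..<k} \<times> {..<k}" by auto
  have fin: "finite ?I" by (rule finite_subset[OF I]) simp
  have card: "real (card ?I) \<le> (real k)\<^sup>2"
    using card_mono[OF _ I] by (simp add: power2_eq_square card_cartesian_product flip: of_nat_mult)
  have "disagreement n k F ?G = measure_pmf.prob (random_profile n k) ({\<sigma>. F \<sigma> \<noteq> ?G \<sigma>} \<inter> profiles n k)"
    unfolding disagreement_def by (simp only: set_pmf_random_profile[symmetric] measure_Int_set_pmf)
  also have "\<dots> \<le> measure_pmf.prob (random_profile n k) (\<Union>p\<in>?I. ?E p)"
  proof (rule measure_pmf.finite_measure_mono)
    show "{\<sigma>. F \<sigma> \<noteq> ?G \<sigma>} \<inter> profiles n k \<subseteq> (\<Union>p\<in>?I. ?E p)"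
    proof (rule subsetI, rule ccontr)
      fix \<sigma> assume \<sigma>: "\<sigma> \<in> {\<sigma>. F \<sigma> \<noteq> ?G \<sigma>} \<inter> profiles n k" and "\<sigma> \<notin> (\<Union>p\<in>?I. ?E p)"
      then have agree: "(a, b) \<in> F \<sigma> \<longleftrightarrow> ((a, b) \<in> \<sigma> i) = s" if "a < k" "b < k" "a \<noteq> b" for a b
        using that by auto
      have "\<sigma> i \<in> rankings k" using vote_ranking \<sigma> i by blast
      then have r: "\<sigma> i \<subseteq> {..<k} \<times> {..<k}" "irrefl (\<sigma> i)"
        by (auto simp: rankings_def strict_linear_order_on_def)
      have Fr: "F \<sigma> \<subseteq> {..<k} \<times> {..<k}" "asym (F \<sigma>)" using F \<sigma> by (auto simp: constitution_def)
      have "(a, b) \<in> F \<sigma> \<longleftrightarrow> (a, b) \<in> ?G \<sigma>" for a b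
      proof (cases "a < k \<and> b < k \<and> a \<noteq> b")
        case True
        then show ?thesis using agree[of a b] vote_reverse_iff[of \<sigma> n k i a b] \<sigma> i by auto
      next
        case False
        then show ?thesis using r Fr by (auto simp: irrefl_def dest: asymD)
      qed
      then have "F \<sigma> = ?G \<sigma>" by auto
      then show False using \<sigma> by simp
    qed
  qed simp
  also have "\<dots> \<le> (\<Sum>p\<in>?I. measure_pmf.prob (random_profile n k) (?E p))"
    by (rule measure_pmf.finite_measure_subadditive_finite[OF fin]) simp
  also have "\<dots> \<le> (\<Sum>p\<in>?I. \<epsilon>)"
    by (rule sum_mono) (use close in \<open>auto simp: pair_distance_def\<close>)
  also have "\<dots> \<le> (real k)\<^sup>2 * \<epsilon>" using card \<epsilon> by (simp add: mult_right_mono)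
  finally show ?thesis .
qed

lemma voter_dictator:
  assumes "i < n"
  shows "constitution n k (\<lambda>\<sigma>. if s then \<sigma> i else (\<sigma> i)\<inverse>)" "dictator n k (\<lambda>\<sigma>. if s then \<sigma> i else (\<sigma> i)\<inverse>)"
proof -
  have "r \<subseteq> {..<k} \<times> {..<k} \<and> asym r \<and> total_on {..<k} r" if "r \<in> rankings k" for r
  proof -
    have r: "r \<subseteq> {..<k} \<times> {..<k}" "trans r" "irrefl r" "total_on {..<k} r"
      using that by (simp_all add: rankings_def strict_linear_order_on_def)
    have "asym r" by (rule asymI) (meson r(2,3) irrefl_def transD)
    with r show ?thesis by blast
  qed
  then have r: "\<sigma> i \<subseteq> {..<k} \<times> {..<k}" "asym (\<sigma> i)" "total_on {..<k} (\<sigma> i)" if "\<sigma> \<in> profiles n k" for \<sigma>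
    using vote_ranking[OF that assms] by auto
  show "constitution n k (\<lambda>\<sigma>. if s then \<sigma> i else (\<sigma> i)\<inverse>)"
    unfolding constitution_def using r by (auto simp: total_on_def asym_iff)
  show "dictator n k (\<lambda>\<sigma>. if s then \<sigma> i else (\<sigma> i)\<inverse>)"
    unfolding dictator_def using assms by (cases s) auto
qed

text \<open>
  The polynomial bound is far larger than the exponential one, because the exponential of
  \<open>1 / \<epsilon>\<close> outgrows every power of \<open>1 / \<epsilon>\<close>. The constant 4000 leaves room for the numerical factors.
\<close>

lemma exp_le_polynomial:
  fixes \<epsilon> :: real
  assumes "0 < \<epsilon>" "\<epsilon> \<le> 1"
  shows "exp (- (256 * 4000 / \<epsilon> ^ 21)) \<le> (\<epsilon> ^ 32 / 2000) ^ 8 / 9"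
proof -
  have "\<epsilon> ^ 21 \<le> \<epsilon>" using power_decreasing[of 1 21 \<epsilon>] assms by simp
  then have "256 * 4000 / \<epsilon> \<le> 256 * 4000 / \<epsilon> ^ 21" using assms by (intro divide_left_mono) auto
  then have "exp (- (256 * 4000 / \<epsilon> ^ 21)) \<le> exp (- (real 256 * (4000 / \<epsilon>)))" by simp
  also have "\<dots> = inverse (exp (4000 / \<epsilon>)) ^ 256"
    by (simp only: exp_minus exp_of_nat_mult power_inverse)
  also have "\<dots> \<le> (\<epsilon> / 4000) ^ 256"
  proof (rule power_mono)
    have "4000 / \<epsilon> \<le> exp (4000 / \<epsilon>)" using exp_ge_add_one_self[of "4000 / \<epsilon>"] by linarith
    then have "inverse (exp (4000 / \<epsilon>)) \<le> inverse (4000 / \<epsilon>)" using assms by (intro le_imp_inverse_le) auto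
    then show "inverse (exp (4000 / \<epsilon>)) \<le> \<epsilon> / 4000" by simp
  qed simp
  also have "\<dots> = \<epsilon> ^ 256 / 4000 ^ 256" by (simp only: power_divide)
  also have "\<dots> \<le> \<epsilon> ^ 256 / 4000 ^ 9"
    using assms by (intro divide_left_mono power_increasing mult_pos_pos zero_less_power) simp_all
  also have "\<dots> \<le> \<epsilon> ^ 256 / (2000 ^ 8 * 9)"
    using assms by (intro divide_left_mono) simp_all
  also have "\<dots> = (\<epsilon> ^ 32 / 2000) ^ 8 / 9"
    by (simp add: power_divide flip: power_mult)
  finally show ?thesis .
qed

text \<open>
  Every triple of alternatives has a dictator that is \<open>\<epsilon>\<close>-close to \<open>F\<close> on its three pairs. Any two
  pairs are connected by a chain of triples, consecutive ones sharing a pair, so a single voter with a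
  single orientation serves all pairs, which contradicts the distance of \<open>F\<close> from the dictators.
\<close>

lemma polynomial_arrow:
  assumes k: "3 \<le> k" and \<epsilon>: "0 < \<epsilon>" and F: "constitution n k F" "IIA n k F"
    and far: "\<And>G. constitution n k G \<Longrightarrow> dictator n k G \<Longrightarrow> (real k)\<^sup>2 * \<epsilon> < disagreement n k F G"
    and fair: "\<And>a b. a < k \<Longrightarrow> b < k \<Longrightarrow> a \<noteq> b \<Longrightarrow>
      (real k)\<^sup>2 * \<epsilon> \<le> measure_pmf.prob (random_profile n k) {\<sigma>. (a, b) \<in> F \<sigma>}"
  shows "\<epsilon> < 1/4" and "(\<epsilon> ^ 32 / 2000) ^ 8 / 9 \<le> prob_nontransitive n k F"
proof -
  have "3\<^sup>2 \<le> (real k)\<^sup>2" using k by (intro power_mono) auto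
  then have k2: "9 * \<epsilon> \<le> (real k)\<^sup>2 * \<epsilon>" using \<epsilon> by (intro mult_right_mono) auto
  let ?f = "pair_outcome n k F"
  \<comment> \<open>Fairness to \<open>(a, b)\<close> and to \<open>(b, a)\<close> keeps the mean away from zero and from one.\<close>
  have mean: "9 * \<epsilon> \<le> cube_avg n (?f a b)" "cube_avg n (?f a b) \<le> 1 - 9 * \<epsilon>"
    if ab: "a < k" "b < k" "a \<noteq> b" for a b
  proof -
    have "measure_pmf.prob (random_profile n k) {\<sigma>. (a, b) \<in> F \<sigma>} = cube_avg n (\<lambda>x. of_bool (?f a b x = 1))"
      by (rule prob_pair_votes[OF k ab]) (simp add: pair_outcome_votes[OF F(2) ab])
    moreover have "(\<lambda>x. of_bool (?f a b x = 1)) = ?f a b" by (auto simp: pair_outcome_def)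
    ultimately have p: "measure_pmf.prob (random_profile n k) {\<sigma>. (a, b) \<in> F \<sigma>} = cube_avg n (?f a b)" by simp
    have "measure_pmf.prob (random_profile n k) {\<sigma>. (b, a) \<in> F \<sigma>} = cube_avg n (\<lambda>x. of_bool (?f a b x = 0))"
      by (rule prob_pair_votes[OF k ab])
        (simp add: pair_outcome_votes[OF F(2) ab] outcome_reverse_iff[OF F(1) _ ab])
    moreover have "(\<lambda>x. of_bool (?f a b x = 0)) = (\<lambda>x. 1 - ?f a b x)" by (auto simp: pair_outcome_def)
    ultimately have q: "measure_pmf.prob (random_profile n k) {\<sigma>. (b, a) \<in> F \<sigma>} = 1 - cube_avg n (?f a b)"
      by (simp add: cube_avg_diff)
    show "9 * \<epsilon> \<le> cube_avg n (?f a b)" "cube_avg n (?f a b) \<le> 1 - 9 * \<epsilon>"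
      using fair[OF ab] fair[of b a] ab k2 p q by auto
  qed
  show \<epsilon>4: "\<epsilon> < 1/4" using mean[of 0 1] k \<epsilon> by auto
  show "(\<epsilon> ^ 32 / 2000) ^ 8 / 9 \<le> prob_nontransitive n k F"
  proof (rule ccontr)
    assume "\<not> ?thesis"
    then have small: "prob_nontransitive n k F < (\<epsilon> ^ 32 / 2000) ^ 8 / 9" by simp
    define close where "close i s a b \<longleftrightarrow> pair_distance n k F i s a b \<le> \<epsilon>" for i s a b
    have close_iff: "close i s a b \<longleftrightarrow> cube_avg n (\<lambda>x. \<bar>?f a b x - of_bool (x i = s)\<bar>) \<le> \<epsilon>"
      if "i < n" "a < k" "b < k" "a \<noteq> b" for i s a b
      unfolding close_def pair_distance_eq[OF k F(2) that] ..
    have sym: "close i s b a" if "close i s a b" "i < n" "a < k" "b < k" "a \<noteq> b" for i s a b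
      using that pair_distance_sym[OF F(1)] by (simp add: close_def)
    have triple: "\<exists>i<n. \<exists>s. close i s a b \<and> close i s b c \<and> close i s c a"
      if abc: "a < k" "b < k" "c < k" "a \<noteq> b" "b \<noteq> c" "c \<noteq> a" for a b c
    proof -
      have "\<epsilon> \<le> cube_avg n (?f a b)" "cube_avg n (?f a b) \<le> 1 - \<epsilon>" "\<epsilon> \<le> cube_avg n (?f b c)"
        "cube_avg n (?f b c) \<le> 1 - \<epsilon>" "\<epsilon> \<le> cube_avg n (?f c a)" "cube_avg n (?f c a) \<le> 1 - \<epsilon>"
        using mean[OF abc(1,2,4)] mean[OF abc(2,3,5)] mean[OF abc(3,1,6)] \<epsilon> by auto
      moreover have "vote_avg n (all_equal (?f a b) (?f b c) (?f c a)) \<le> (\<epsilon> ^ 32 / 2000) ^ 8 / 9"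
        using prob_cycle_le[OF F abc] small by linarith
      ultimately obtain i s where "i < n" "cube_avg n (\<lambda>x. \<bar>?f a b x - of_bool (x i = s)\<bar>) \<le> \<epsilon>"
        "cube_avg n (\<lambda>x. \<bar>?f b c x - of_bool (x i = s)\<bar>) \<le> \<epsilon>"
        "cube_avg n (\<lambda>x. \<bar>?f c a x - of_bool (x i = s)\<bar>) \<le> \<epsilon>"
        using close_to_common_dictator[of "?f a b" "?f b c" "?f c a" \<epsilon> n,
            OF pair_outcome_bool pair_outcome_bool pair_outcome_bool] \<epsilon> \<epsilon>4 by auto
      then show ?thesis using close_iff abc by blast
    qed
    obtain i s where i: "i < n" and close01: "close i s 0 1" using triple[of 0 1 2] k by auto
    have spread: "close i s b c \<and> close i s c a"
      if ab: "close i s a b" and abc: "a < k" "b < k" "c < k" "a \<noteq> b" "b \<noteq> c" "c \<noteq> a" for a b c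
    proof -
      obtain j t where j: "j < n" "close j t a b" "close j t b c" "close j t c a"
        using triple[OF abc] by blast
      then have "i = j \<and> s = t"
        using dictator_unique[OF i j(1) \<epsilon>4, of "?f a b" s t] close_iff[OF _ abc(1,2,4)] ab i by blast
      then show ?thesis using j by simp
    qed
    have outside: "close i s a b" if "a < k" "b < k" "a \<noteq> b" "a \<noteq> 0" "a \<noteq> 1" for a b
    proof -
      have 1: "close i s 1 a" "close i s a 0" using spread[OF close01, of a] that k by auto
      have "close i s b a" if "b \<noteq> 0" using spread[OF 1(2), of b] \<open>a < k\<close> \<open>b < k\<close> \<open>a \<noteq> b\<close> \<open>a \<noteq> 0\<close> that k by auto
      then show ?thesis using 1 sym[of i s b a] that i by (cases "b = 0") auto
    qed
    have all: "close i s a b" if "a < k" "b < k" "a \<noteq> b" for a b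
    proof (cases "a \<in> {0, 1} \<and> b \<in> {0, 1}")
      case True
      then show ?thesis using close01 sym[OF close01 i] that by auto
    next
      case False
      then show ?thesis using outside[of a b] outside[of b a] sym[of i s b a] that i by auto
    qed
    have "disagreement n k F (\<lambda>\<sigma>. if s then \<sigma> i else (\<sigma> i)\<inverse>) \<le> (real k)\<^sup>2 * \<epsilon>"
      by (rule disagreement_le[OF F(1) i]) (use all \<epsilon> in \<open>auto simp: close_def\<close>)
    then show False using far[OF voter_dictator[OF i, of k s]] by (meson leD)
  qed
qed

theorem corollary1p4:
  "\<exists>C::real. C > 0 \<and>
     (\<forall>(k::nat) (\<epsilon>::real). k \<ge> 3 \<longrightarrow> \<epsilon> > 0 \<longrightarrow>
       (let \<delta> = exp (- (C / \<epsilon> ^ 21)) in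
         \<forall>(n::nat) F. n \<ge> 1 \<longrightarrow> constitution n k F \<longrightarrow>
           IIA n k F \<longrightarrow>
           (\<forall>G. constitution n k G \<longrightarrow> dictator n k G \<longrightarrow> disagreement n k F G > (real k)\<^sup>2 * \<epsilon>) \<longrightarrow>
           (\<forall>a<k. \<forall>b<k. a \<noteq> b \<longrightarrow>
              measure_pmf.prob (random_profile n k) {\<sigma>. (a, b) \<in> F \<sigma>} \<ge> (real k)\<^sup>2 * \<epsilon>) \<longrightarrow>
           prob_nontransitive n k F \<ge> \<delta>))"
  unfolding Let_def
proof (intro exI[of _ "256 * 4000"] conjI allI impI)
  fix k n :: nat and \<epsilon> :: real and F :: "(nat \<Rightarrow> nat rel) \<Rightarrow> nat rel"
  assume k: "3 \<le> k" and \<epsilon>: "0 < \<epsilon>" and F: "constitution n k F" "IIA n k F"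
    and far: "\<forall>G. constitution n k G \<longrightarrow> dictator n k G \<longrightarrow> (real k)\<^sup>2 * \<epsilon> < disagreement n k F G"
    and fair: "\<forall>a<k. \<forall>b<k. a \<noteq> b \<longrightarrow>
      (real k)\<^sup>2 * \<epsilon> \<le> measure_pmf.prob (random_profile n k) {\<sigma>. (a, b) \<in> F \<sigma>}"
  have "\<epsilon> < 1/4" and bound: "(\<epsilon> ^ 32 / 2000) ^ 8 / 9 \<le> prob_nontransitive n k F"
    using polynomial_arrow[OF k \<epsilon> F] far fair by blast+
  then have "\<epsilon> \<le> 1" by simp
  from order_trans[OF exp_le_polynomial[OF \<epsilon> this] bound]
  show "exp (- (256 * 4000 / \<epsilon> ^ 21)) \<le> prob_nontransitive n k F" .
qed simp

end
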